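(* Let $g\ge 2$ and let $H\subset\mathrm{GSp}_{2g}(\mathbb Z_2)$ be a subgroup such that $H=\pi_{2^\infty\to2}^{-1}(H(2))$ and $H(2)\supset S_{2g+1}$. Then \[ [H,H]=\varphi_{2^\infty\to 2}^{-1}\big([H(2),H(2)]\big). \] Moreover, the homomorphism $H\to H(2)^{\mathrm{ab}}\times\mathbb Z_2^\times$ whose first component is reduction mod 2 followed by abelianization $H(2)\to H(2)^{\mathrm{ab}}$ and whose second component is the multiplier map induces an isomorphism $H^{\mathrm{ab}}\cong H(2)^{\mathrm{ab}}\times\mathbb Z_2^\times$.
   Context: $\pi_{2^\infty\to2}:\mathrm{GSp}_{2g}(\mathbb Z_2)\to\mathrm{GSp}_{2g}(\mathbb Z/2\mathbb Z)$ and $\varphi_{2^\infty\to2}:\mathrm{Sp}_{2g}(\mathbb Z_2)\to\mathrm{Sp}_{2g}(\mathbb Z/2\mathbb Z)$ are reduction maps; $H(2)$ is the image of $H$ mod 2. For a topological group $G$, $[G,G]$ is the closure of the commutator subgroup and $G^{\mathrm{ab}}=G/[G,G]$. The multiplier $\mathrm{mult}(S)$ is the scalar with $\langle Sv,Sw\rangle=\mathrm{mult}(S)\langle v,w\rangle$. The embedding $S_{2g+1}\subset S_{2g+2}\subset\mathrm{Sp}_{2g}(\mathbb Z/2\mathbb Z)$: let $V=\mathbb F_2^{2g+2}$ with the standard dot product, $t=(1,\dots,1)$, $W=t^\perp/\mathrm{span}(t)$ with the induced nondegenerate alternating form; $S_{2g+2}$ acts on $W$ by permuting coordinates, and after identifying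 $W$ symplectically with $\mathbb F_2^{2g}$ (with the mod-2 reduction of the symplectic form) this gives $S_{2g+2}\subset\mathrm{Sp}_{2g}(\mathbb Z/2\mathbb Z)$; $S_{2g+1}$ is the stabilizer of the last coordinate. *)

theory Defs
  imports
    "HOL-Analysis.Analysis"
    "HOL-Algebra.Generated_Groups"
    "HOL-Library.Z2"
begin

(* clashes with the infix closure_of of abstract topology *)
no_notation eq_closure_of (\<open>closure'_of\<index>\<close>)

section \<open>The 2-adic integers\<close>

text \<open>\<open>\<int>\<^sub>2\<close> is the inverse limit of the rings \<open>\<int>/2\<^sup>n\<int>\<close>. Component \<open>n\<close> of a coherent
  sequence is the representative of the residue class in \<open>{0..<2^n}\<close>; the case \<open>m = n\<close> of the
  condition below forces it to be reduced.\<close>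

typedef z2adic = "{x :: nat \<Rightarrow> int. \<forall>m n. m \<le> n \<longrightarrow> x n mod 2 ^ m = x m}"
  morphisms residue_at Abs_z2adic
  by (rule exI[of _ "\<lambda>_. 0"]) simp

setup_lifting type_definition_z2adic

lemma mod_power_two_mod [simp]:
  fixes a :: int
  assumes "m \<le> n"
  shows "a mod 2 ^ n mod 2 ^ m = a mod 2 ^ m"
  using assms by (simp add: mod_mod_cancel le_imp_power_dvd)

instantiation z2adic :: comm_ring_1
begin

lift_definition zero_z2adic :: z2adic is "\<lambda>_. 0" by simp

lift_definition one_z2adic :: z2adic is "\<lambda>n. 1 mod 2 ^ n" by simp

lift_definition plus_z2adic :: "z2adic \<Rightarrow> z2adic \<Rightarrow> z2adic"
  is "\<lambda>x y n. (x n + y n) mod 2 ^ n"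
proof -
  fix x y :: "nat \<Rightarrow> int" and m n :: nat
  assume x: "\<And>m n. m \<le> n \<Longrightarrow> x n mod 2 ^ m = x m"
    and y: "\<And>m n. m \<le> n \<Longrightarrow> y n mod 2 ^ m = y m"
    and mn: "m \<le> n"
  show "(x n + y n) mod 2 ^ n mod 2 ^ m = (x m + y m) mod 2 ^ m"
    using mod_add_eq[of "x n" "2 ^ m" "y n"] mn x[OF mn] y[OF mn] by simp
qed

lift_definition uminus_z2adic :: "z2adic \<Rightarrow> z2adic"
  is "\<lambda>x n. (- x n) mod 2 ^ n"
proof -
  fix x :: "nat \<Rightarrow> int" and m n :: nat
  assume x: "\<And>m n. m \<le> n \<Longrightarrow> x n mod 2 ^ m = x m" and mn: "m \<le> n"
  show "(- x n) mod 2 ^ n mod 2 ^ m = (- x m) mod 2 ^ m"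
    using mod_minus_eq[of "x n" "2 ^ m"] mn x[OF mn] by simp
qed

lift_definition minus_z2adic :: "z2adic \<Rightarrow> z2adic \<Rightarrow> z2adic"
  is "\<lambda>x y n. (x n - y n) mod 2 ^ n"
proof -
  fix x y :: "nat \<Rightarrow> int" and m n :: nat
  assume x: "\<And>m n. m \<le> n \<Longrightarrow> x n mod 2 ^ m = x m"
    and y: "\<And>m n. m \<le> n \<Longrightarrow> y n mod 2 ^ m = y m"
    and mn: "m \<le> n"
  show "(x n - y n) mod 2 ^ n mod 2 ^ m = (x m - y m) mod 2 ^ m"
    using mod_diff_eq[of "x n" "2 ^ m" "y n"] mn x[OF mn] y[OF mn] by simp
qed

lift_definition times_z2adic :: "z2adic \<Rightarrow> z2adic \<Rightarrow> z2adic"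
  is "\<lambda>x y n. (x n * y n) mod 2 ^ n"
proof -
  fix x y :: "nat \<Rightarrow> int" and m n :: nat
  assume x: "\<And>m n. m \<le> n \<Longrightarrow> x n mod 2 ^ m = x m"
    and y: "\<And>m n. m \<le> n \<Longrightarrow> y n mod 2 ^ m = y m"
    and mn: "m \<le> n"
  show "(x n * y n) mod 2 ^ n mod 2 ^ m = (x m * y m) mod 2 ^ m"
    using mod_mult_eq[of "x n" "2 ^ m" "y n"] mn x[OF mn] y[OF mn] by simp
qed

instance
proof
  fix a b c :: z2adic
  show "a * b * c = a * (b * c)"
    by transfer (simp add: fun_eq_iff mod_mult_left_eq mod_mult_right_eq mult.assoc)
  show "a * b = b * a"
    by transfer (simp add: fun_eq_iff mult.commute)
  show "1 * a = a"
    by transfer (simp only: mod_mult_left_eq mult_1 mem_Collect_eq order_refl simp_thms)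
  show "a + b + c = a + (b + c)"
    by transfer (simp add: fun_eq_iff mod_add_left_eq mod_add_right_eq add.assoc)
  show "a + b = b + a"
    by transfer (simp add: fun_eq_iff add.commute)
  show "0 + a = a"
    by transfer simp
  show "- a + a = 0"
    by transfer (simp add: fun_eq_iff mod_add_left_eq)
  show "a - b = a + - b"
    by transfer (simp add: fun_eq_iff mod_add_right_eq)
  show "(a + b) * c = a * c + b * c"
    by transfer (simp add: fun_eq_iff mod_mult_left_eq mod_add_eq distrib_right)
  show "(0 :: z2adic) \<noteq> 1"
    by transfer (auto simp: fun_eq_iff intro!: exI[of _ 1])
qed

end

instantiation z2adic :: topological_space
begin

text \<open>The inverse limit topology: the cosets of \<open>2\<^sup>n\<int>\<^sub>2\<close> form a basis.\<close>

definition open_z2adic :: "z2adic set \<Rightarrow> bool" where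
  "open_z2adic U \<longleftrightarrow>
     (\<forall>x\<in>U. \<exists>n. \<forall>y. residue_at y n = residue_at x n \<longrightarrow> y \<in> U)"

instance
proof
  show "open (UNIV :: z2adic set)"
    by (simp add: open_z2adic_def)
next
  fix S T :: "z2adic set"
  assume S: "open S" and T: "open T"
  show "open (S \<inter> T)"
    unfolding open_z2adic_def
  proof
    fix x assume x: "x \<in> S \<inter> T"
    obtain m where m: "\<And>y. residue_at y m = residue_at x m \<Longrightarrow> y \<in> S"
      using S x unfolding open_z2adic_def by blast
    obtain n where n: "\<And>y. residue_at y n = residue_at x n \<Longrightarrow> y \<in> T"
      using T x unfolding open_z2adic_def by blast
    have coherent: "residue_at z k = residue_at z (max m n) mod 2 ^ k"
      if "k \<le> max m n" for z k
      using residue_at[of z] that by (simp only: mem_Collect_eq)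
    have "y \<in> S \<inter> T" if y: "residue_at y (max m n) = residue_at x (max m n)" for y
    proof
      show "y \<in> S"
        by (rule m) (simp only: coherent[OF max.cobounded1] y)
      show "y \<in> T"
        by (rule n) (simp only: coherent[OF max.cobounded2] y)
    qed
    then show "\<exists>n. \<forall>y. residue_at y n = residue_at x n \<longrightarrow> y \<in> S \<inter> T"
      by blast
  qed
next
  fix K :: "z2adic set set"
  assume K: "\<forall>S\<in>K. open S"
  show "open (\<Union> K)"
    unfolding open_z2adic_def
  proof
    fix x assume "x \<in> \<Union> K"
    then obtain S where S: "S \<in> K" "x \<in> S" by blast
    then obtain n where "\<forall>y. residue_at y n = residue_at x n \<longrightarrow> y \<in> S"
      using K unfolding open_z2adic_def by meson
    then show "\<exists>n. \<forall>y. residue_at y n = residue_at x n \<longrightarrow> y \<in> \<Union> K"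
      using S(1) by (intro exI[of _ n]) auto
  qed
qed

end

definition red2 :: "z2adic \<Rightarrow> bit" where
  "red2 x = of_int (residue_at x 1)"

abbreviation red2_mat :: "z2adic ^ 'n::finite ^ 'm::finite \<Rightarrow> bit ^ 'n ^ 'm" where
  "red2_mat \<equiv> map_matrix red2"

definition z2_units :: "z2adic monoid" where
  "z2_units = \<lparr>carrier = {u. u dvd 1}, mult = (*), one = 1\<rparr>"

abbreviation z2_units_topology :: "z2adic topology" where
  "z2_units_topology \<equiv> top_of_set (carrier z2_units)"


section \<open>Symplectic similitudes\<close>

text \<open>Vectors of \<open>R\<^sup>2\<^sup>g\<close> are indexed by \<open>'g + 'g\<close> with \<open>g = CARD('g)\<close>, the two summands indexing
  the two halves of a symplectic basis.\<close>

definition symp_form :: "'a::comm_ring_1 ^ ('g::finite + 'g) \<Rightarrow> 'a ^ ('g + 'g) \<Rightarrow> 'a" where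
  "symp_form v w = (\<Sum>i\<in>UNIV. v $ Inl i * w $ Inr i - v $ Inr i * w $ Inl i)"

definition is_multiplier :: "'a::comm_ring_1 ^ ('g::finite + 'g) ^ ('g + 'g) \<Rightarrow> 'a \<Rightarrow> bool" where
  "is_multiplier S c \<longleftrightarrow> (\<forall>v w. symp_form (S *v v) (S *v w) = c * symp_form v w)"

definition multiplier :: "'a::comm_ring_1 ^ ('g::finite + 'g) ^ ('g + 'g) \<Rightarrow> 'a" where
  "multiplier S = (THE c. is_multiplier S c)"

definition GSp :: "('a::comm_ring_1 ^ ('g::finite + 'g) ^ ('g + 'g)) monoid" where
  "GSp = \<lparr>carrier = {S. invertible S \<and> (\<exists>c. c dvd 1 \<and> is_multiplier S c)},
          mult = (**), one = mat 1\<rparr>"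

definition Sp :: "('a::comm_ring_1 ^ ('g::finite + 'g) ^ ('g + 'g)) monoid" where
  "Sp = \<lparr>carrier = {S. invertible S \<and> is_multiplier S 1}, mult = (**), one = mat 1\<rparr>"


section \<open>The symmetric group inside the symplectic group over \<open>\<F>\<^sub>2\<close>\<close>

text \<open>The coordinates of \<open>V = \<F>\<^sub>2\<^sup>2\<^sup>g\<^sup>+\<^sup>2\<close> are indexed by a type \<open>'m\<close>, to be used with
  \<open>CARD('m) = 2 * CARD('g) + 2\<close>.\<close>

definition dot2 :: "bit ^ 'm::finite \<Rightarrow> bit ^ 'm \<Rightarrow> bit" where
  "dot2 v w = (\<Sum>i\<in>UNIV. v $ i * w $ i)"

definition all_ones :: "bit ^ 'm::finite" where
  "all_ones = (\<chi> i. 1)"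

definition ones_perp :: "(bit ^ 'm::finite) set" where
  "ones_perp = {v. dot2 v all_ones = 0}"

definition ones_class :: "bit ^ 'm::finite \<Rightarrow> (bit ^ 'm) set" where
  "ones_class v = (+) v ` vec.span {all_ones}"

definition W_space :: "(bit ^ 'm::finite) set set" where
  "W_space = ones_class ` ones_perp"

text \<open>A symplectic identification of \<open>W = t\<^sup>\<bottom>/span(t)\<close> with \<open>\<F>\<^sub>2\<^sup>2\<^sup>g\<close>. The vector space structure
  and the form on \<open>W\<close> are the ones induced from representatives.\<close>

definition symp_identification ::
    "((bit ^ 'm::finite) set \<Rightarrow> bit ^ ('g::finite + 'g)) \<Rightarrow> bool" where
  "symp_identification \<iota> \<longleftrightarrow>
     bij_betw \<iota> W_space UNIV \<and>
     (\<forall>v\<in>ones_perp. \<forall>w\<in>ones_perp.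
        \<iota> (ones_class (v + w)) = \<iota> (ones_class v) + \<iota> (ones_class w)) \<and>
     (\<forall>c. \<forall>v\<in>ones_perp. \<iota> (ones_class (c *s v)) = c *s \<iota> (ones_class v)) \<and>
     (\<forall>v\<in>ones_perp. \<forall>w\<in>ones_perp.
        symp_form (\<iota> (ones_class v)) (\<iota> (ones_class w)) = dot2 v w)"

definition permute_coords :: "('m \<Rightarrow> 'm) \<Rightarrow> bit ^ 'm::finite \<Rightarrow> bit ^ 'm" where
  "permute_coords \<sigma> v = (\<chi> i. v $ (inv_into UNIV \<sigma> i))"

definition acts_as_perm ::
    "((bit ^ 'm::finite) set \<Rightarrow> bit ^ ('g::finite + 'g)) \<Rightarrow> bit ^ ('g + 'g) ^ ('g + 'g)
      \<Rightarrow> ('m \<Rightarrow> 'm) \<Rightarrow> bool" where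
  "acts_as_perm \<iota> M \<sigma> \<longleftrightarrow>
     (\<forall>v\<in>ones_perp. M *v \<iota> (ones_class v) = \<iota> (ones_class (permute_coords \<sigma> v)))"

text \<open>The image of \<open>S\<^sub>2\<^sub>g\<^sub>+\<^sub>1\<close>, the stabilizer of the coordinate \<open>l\<close> in \<open>S\<^sub>2\<^sub>g\<^sub>+\<^sub>2\<close>.\<close>

definition sym_stabilizer ::
    "((bit ^ 'm::finite) set \<Rightarrow> bit ^ ('g::finite + 'g)) \<Rightarrow> 'm
      \<Rightarrow> (bit ^ ('g + 'g) ^ ('g + 'g)) set" where
  "sym_stabilizer \<iota> l = {M. \<exists>\<sigma>. \<sigma> permutes UNIV \<and> \<sigma> l = l \<and> acts_as_perm \<iota> M \<sigma>}"


section \<open>Topological abelianization\<close>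

definition quot_topology :: "'a topology \<Rightarrow> ('a \<Rightarrow> 'b) \<Rightarrow> 'b topology" where
  "quot_topology X f =
     topology (\<lambda>U. U \<subseteq> f ` topspace X \<and> openin X {x \<in> topspace X. f x \<in> U})"

lemma openin_quot_topology:
  "openin (quot_topology X f) U \<longleftrightarrow>
     U \<subseteq> f ` topspace X \<and> openin X {x \<in> topspace X. f x \<in> U}"
proof -
  have "istopology (\<lambda>U. U \<subseteq> f ` topspace X \<and> openin X {x \<in> topspace X. f x \<in> U})"
    unfolding istopology_def
  proof (intro conjI allI impI)
    fix S T
    assume S: "S \<subseteq> f ` topspace X \<and> openin X {x \<in> topspace X. f x \<in> S}"
      and T: "T \<subseteq> f ` topspace X \<and> openin X {x \<in> topspace X. f x \<in> T}"
    show "S \<inter> T \<subseteq> f ` topspace X" using S by blast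
    have "{x \<in> topspace X. f x \<in> S \<inter> T} =
        {x \<in> topspace X. f x \<in> S} \<inter> {x \<in> topspace X. f x \<in> T}" by blast
    then show "openin X {x \<in> topspace X. f x \<in> S \<inter> T}" using S T by auto
  next
    fix K
    assume K: "\<forall>S\<in>K. S \<subseteq> f ` topspace X \<and> openin X {x \<in> topspace X. f x \<in> S}"
    show "\<Union> K \<subseteq> f ` topspace X" using K by blast
    have "{x \<in> topspace X. f x \<in> \<Union> K} = (\<Union>S\<in>K. {x \<in> topspace X. f x \<in> S})" by blast
    then show "openin X {x \<in> topspace X. f x \<in> \<Union> K}" using K by auto
  qed
  then show ?thesis
    by (simp add: quot_topology_def)
qed

text \<open>In the following, \<open>X\<close> is the topology of the group \<open>G\<close>, with \<open>topspace X = carrier G\<close>.\<close>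

definition top_derived :: "'a topology \<Rightarrow> ('a, 'b) monoid_scheme \<Rightarrow> 'a set" where
  "top_derived X G = X closure_of (derived G (carrier G))"

definition top_ab :: "'a topology \<Rightarrow> ('a, 'b) monoid_scheme \<Rightarrow> 'a set monoid" where
  "top_ab X G = G Mod top_derived X G"

definition ab_class :: "'a topology \<Rightarrow> ('a, 'b) monoid_scheme \<Rightarrow> 'a \<Rightarrow> 'a set" where
  "ab_class X G x = top_derived X G #>\<^bsub>G\<^esub> x"

definition ab_topology :: "'a topology \<Rightarrow> ('a, 'b) monoid_scheme \<Rightarrow> 'a set topology" where
  "ab_topology X G = quot_topology X (ab_class X G)"

end

theory Submission
  imports Defs "HOL-Number_Theory.Modular_Inverse"
begin

text \<open>That \<open>[H, H]\<close> lies in the preimage is clear. Conversely, an element of the preimage is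
  approximated by \<open>[H, H]\<close> one level of the congruence filtration \<open>\<Gamma>(2\<^sup>n)\<close> at a time, so it
  suffices that \<open>[H, H]\<close> meets every class of \<open>\<Gamma>(2\<^sup>n)/\<Gamma>(2\<^sup>n\<^sup>+\<^sup>1) = sp(\<F>\<^sub>2)\<close>, \<open>n \<ge> 1\<close>. The commutator
  of a lift of \<open>T \<in> H(2)\<close> with an element of class \<open>A \<in> gsp(\<F>\<^sub>2)\<close> has class \<open>T A T\<^sup>-\<^sup>1 - A\<close>.
  Transpositions of coordinates act as the transvections \<open>T\<close> along the images \<open>w\<close> of \<open>e\<^sub>i + e\<^sub>j\<close>, and
  these \<open>w\<close> span \<open>\<F>\<^sub>2\<^sup>2\<^sup>g\<close> even if one coordinate is left out. If \<open>A\<close> has infinitesimal multiplier \<open>\<mu>\<close>,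
  then \<open>T A T\<^sup>-\<^sup>1 - A = (\<mu> - \<langle>w, A w\<rangle>) w \<otimes> w - (A w \<otimes> w + w \<otimes> A w)\<close>. Taking for \<open>A\<close> the
  \<open>v \<otimes> v\<close> and the projection onto a Lagrangian subspace, for which \<open>\<mu> = 1\<close>, one obtains \<open>w \<otimes> w\<close>
  and \<open>v \<otimes> w + w \<otimes> v\<close> for these \<open>w\<close> and all \<open>v\<close>, and they span \<open>sp(\<F>\<^sub>2)\<close>.

  The map to \<open>H(2)\<^sup>a\<^sup>b \<times> \<int>\<^sub>2\<^sup>\<times>\<close> therefore has kernel \<open>[H, H]\<close>; it is open and onto because of the
  matrices \<open>diag(u, 1)\<close>, which are close to the identity whenever \<open>u\<close> is close to \<open>1\<close>.\<close>

text \<open>These rules would turn ring arithmetic on \<open>bit\<close> into bit operations.\<close>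

declare add_bit_eq_xor [simp del] mult_bit_eq_and [simp del]
  minus_bit_def [simp del] uminus_bit_def [simp del]

section \<open>Surjective ring homomorphisms\<close>

locale surj_ring_hom =
  fixes f :: "'a::comm_ring_1 \<Rightarrow> 'b::comm_ring_1"
  assumes hom_add [simp]: "f (x + y) = f x + f y"
    and hom_mult [simp]: "f (x * y) = f x * f y"
    and hom_one [simp]: "f 1 = 1"
    and surj: "surj f"
begin

sublocale additive f
  by unfold_locales simp

lemmas hom_zero [simp] = zero and hom_minus [simp] = minus and hom_diff [simp] = diff
  and hom_sum [simp] = sum

lemma hom_dvd_one: "u dvd 1 \<Longrightarrow> f u dvd 1"
  by (metis dvd_def hom_mult hom_one)

end

section \<open>Arithmetic of the 2-adic integers\<close>

lemma residue_at_mod: "m \<le> n \<Longrightarrow> residue_at x n mod 2 ^ m = residue_at x m"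
  using residue_at[of x] by simp

lemma residue_at_mod_self [simp]: "residue_at x n mod 2 ^ n = residue_at x n"
  by (rule residue_at_mod) simp

lemma residue_at_of_nat: "residue_at (of_nat k) n = int k mod 2 ^ n"
  by (induction k)
    (simp_all add: zero_z2adic.rep_eq plus_z2adic.rep_eq one_z2adic.rep_eq mod_add_right_eq)

lemma residue_at_two_power_mult: "residue_at (2 ^ k * x) n = 2 ^ k * residue_at x n mod 2 ^ n"
  using residue_at_of_nat[of "2 ^ k" n] by (simp add: times_z2adic.rep_eq mod_mult_left_eq)

lemma coherent_residues_lift:
  assumes "\<And>m n. m \<le> n \<Longrightarrow> [f n = f m] (mod 2 ^ m)"
  obtains x where "\<And>n. residue_at x n = f n mod 2 ^ n"
proof
  have "(\<lambda>n. f n mod 2 ^ n) \<in> {x. \<forall>m n. m \<le> n \<longrightarrow> x n mod 2 ^ m = x m}"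
    by (auto intro: assms[unfolded cong_def])
  then show "residue_at (Abs_z2adic (\<lambda>n. f n mod 2 ^ n)) n = f n mod 2 ^ n" for n
    by (simp only: Abs_z2adic_inverse)
qed

lemma residue_at_eq_0_iff: "residue_at z n = 0 \<longleftrightarrow> 2 ^ n dvd z"
proof
  assume "2 ^ n dvd z"
  then show "residue_at z n = 0"
    by (auto elim!: dvdE simp: residue_at_two_power_mult)
next
  assume z: "residue_at z n = 0"
  define quotient where "quotient m = residue_at z (m + n) div 2 ^ n" for m
  have quotient: "2 ^ n * quotient m = residue_at z (m + n)" for m
    using residue_at_mod[of n "m + n" z] z by (simp add: quotient_def mod_eq_0_iff_dvd)
  have "[quotient k = quotient m] (mod 2 ^ m)" if "m \<le> k" for m k
  proof -
    have "[2 ^ n * quotient k = 2 ^ n * quotient m] (mod 2 ^ n * 2 ^ m)"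
      unfolding quotient cong_def power_add[symmetric]
      using residue_at_mod[of "m + n" "k + n" z] that by (simp add: add.commute)
    then show ?thesis by (simp add: cong_def mult_mod_right[symmetric])
  qed
  then obtain x where x: "\<And>m. residue_at x m = quotient m mod 2 ^ m"
    using coherent_residues_lift by blast
  have "residue_at (2 ^ n * x) m = residue_at z m" for m
    using residue_at_mod[of m "m + n" z]
    by (simp add: residue_at_two_power_mult x mod_mult_right_eq quotient)
  then have "2 ^ n * x = z" by (simp add: residue_at_inject[symmetric] fun_eq_iff)
  then show "2 ^ n dvd z" by auto
qed

lemma residue_at_eq_iff: "residue_at x n = residue_at y n \<longleftrightarrow> 2 ^ n dvd x - y"
proof -
  have "2 ^ n dvd x - y \<longleftrightarrow> (residue_at x n - residue_at y n) mod 2 ^ n = 0"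
    by (simp add: residue_at_eq_0_iff[symmetric] minus_z2adic.rep_eq)
  also have "\<dots> \<longleftrightarrow> residue_at x n mod 2 ^ n = residue_at y n mod 2 ^ n"
    by (simp only: mod_eq_dvd_iff mod_eq_0_iff_dvd)
  finally show ?thesis by simp
qed

lemma z2adic_eqI: "(\<And>n. 2 ^ n dvd x - y) \<Longrightarrow> x = (y :: z2adic)"
  by (simp add: residue_at_inject[symmetric] fun_eq_iff residue_at_eq_iff)

lemma two_power_mult_left_cancel: "2 ^ n * x = 2 ^ n * y \<longleftrightarrow> x = (y :: z2adic)"
proof
  assume eq: "2 ^ n * x = 2 ^ n * y"
  show "x = y"
  proof (rule z2adic_eqI)
    fix m
    have "2 ^ n * residue_at (x - y) (n + m) mod (2 ^ n * 2 ^ m) = 0"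
      using residue_at_two_power_mult[of n "x - y" "n + m"] eq
      by (simp add: right_diff_distrib power_add zero_z2adic.rep_eq)
    then have "residue_at (x - y) m = 0"
      using residue_at_mod[of m "n + m" "x - y"] by (simp add: mult_mod_right[symmetric])
    then show "2 ^ m dvd x - y" by (simp add: residue_at_eq_0_iff)
  qed
qed simp

lemma coprime_residues_imp_unit:
  assumes "\<And>n. coprime (residue_at u n) (2 ^ n)"
  shows "u dvd 1"
proof -
  define inverse_mod where "inverse_mod n = modular_inverse (2 ^ n) (residue_at u n)" for n
  have inverse_mod: "[residue_at u n * inverse_mod n = 1] (mod 2 ^ n)" for n
    unfolding inverse_mod_def by (rule cong_modular_inverse1[OF assms])
  have "[inverse_mod k = inverse_mod m] (mod 2 ^ m)" if "m \<le> k" for m k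
  proof -
    have "[residue_at u m = residue_at u k] (mod 2 ^ m)"
      using residue_at_mod[OF that, of u] by (simp add: cong_def)
    then have "[residue_at u m * inverse_mod k = residue_at u k * inverse_mod k] (mod 2 ^ m)"
      by (rule cong_scalar_right)
    also have "[residue_at u k * inverse_mod k = 1] (mod 2 ^ m)"
      using inverse_mod[of k] by (rule cong_dvd_modulus) (rule le_imp_power_dvd[OF that])
    also have "[1 = residue_at u m * inverse_mod m] (mod 2 ^ m)"
      by (rule cong_sym[OF inverse_mod])
    finally show ?thesis using assms by (simp add: cong_mult_lcancel)
  qed
  then obtain x where x: "\<And>n. residue_at x n = inverse_mod n mod 2 ^ n"
    using coherent_residues_lift by blast
  have "u * x = 1"
    using inverse_mod
    by (simp add: residue_at_inject[symmetric] fun_eq_iff times_z2adic.rep_eq x one_z2adic.rep_eq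
        cong_def mod_mult_right_eq)
  then show ?thesis by (metis dvdI)
qed

lemma bit_of_int_mod_2: "(of_int (k mod 2) :: bit) = of_int k"
proof -
  have "(of_int k :: bit) = of_int (2 * (k div 2) + k mod 2)" by simp
  also have "\<dots> = of_int (k mod 2)" by (simp only: of_int_add of_int_mult) simp
  finally show ?thesis by simp
qed

lemma bit_of_int_eq_0_iff: "(of_int k :: bit) = 0 \<longleftrightarrow> even k"
  using bit_of_int_mod_2[of k] by (cases "even k") (simp_all add: odd_iff_mod_2_eq_one)

lemma red2_eq_0_iff: "red2 x = 0 \<longleftrightarrow> 2 dvd x"
  using residue_at_eq_0_iff[of x 1] residue_at_mod_self[of x 1]
  by (auto simp: red2_def bit_of_int_eq_0_iff mod_eq_0_iff_dvd simp flip: odd_iff_mod_2_eq_one)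

interpretation red2: surj_ring_hom red2
proof
  fix x y
  show "red2 (x + y) = red2 x + red2 y" "red2 (x * y) = red2 x * red2 y"
    by (simp_all add: red2_def plus_z2adic.rep_eq times_z2adic.rep_eq bit_of_int_mod_2)
  show one: "red2 1 = 1" by (simp add: red2_def one_z2adic.rep_eq)
  have zero: "red2 0 = 0" by (simp add: red2_def zero_z2adic.rep_eq)
  show "surj red2"
  proof (rule surjI)
    fix b :: bit show "red2 (case b of 0 \<Rightarrow> 0 | 1 \<Rightarrow> 1) = b"
      using zero one by (cases b) simp_all
  qed
qed

lemma red2_two_power: "n \<ge> 1 \<Longrightarrow> red2 (2 ^ n) = 0"
  by (simp add: red2_eq_0_iff dvd_power)

lemma z2adic_unit_iff: "u dvd 1 \<longleftrightarrow> red2 u = 1"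
proof
  assume "u dvd 1"
  then have "red2 u dvd 1" by (rule red2.hom_dvd_one)
  then show "red2 u = 1" by (cases "red2 u") simp_all
next
  assume "red2 u = 1"
  then have odd: "odd (residue_at u 1)" by (simp add: red2_def flip: bit_of_int_eq_0_iff)
  have "coprime (residue_at u n) (2 ^ n)" for n
  proof (cases "n = 0")
    case False
    then have "odd (residue_at u n)"
      using odd residue_at_mod[of 1 n u] dvd_mod_iff[of 2 2 "residue_at u n"] by simp
    then show ?thesis by simp
  qed simp
  then show "u dvd 1" by (rule coprime_residues_imp_unit)
qed

section \<open>Scalar multiples of matrices\<close>

definition scale_mat :: "'a::comm_ring_1 \<Rightarrow> 'a ^ 'n ^ 'm \<Rightarrow> 'a ^ 'n ^ 'm" (infixr \<open>*\<^sub>M\<close> 75)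
  where "c *\<^sub>M A = map_matrix ((*) c) A"

lemma scale_mat_nth [simp]: "(c *\<^sub>M A) $ i $ j = c * A $ i $ j"
  by (simp add: scale_mat_def)

interpretation matrix_space: module "scale_mat :: 'a::comm_ring_1 \<Rightarrow> 'a ^ 'n ^ 'm \<Rightarrow> _"
  by unfold_locales (simp_all add: vec_eq_iff algebra_simps)

lemma scale_mat_mult_left: "(c *\<^sub>M A) ** B = c *\<^sub>M (A ** B)"
  and scale_mat_mult_right: "A ** (c *\<^sub>M B) = c *\<^sub>M (A ** B)"
  by (simp_all add: vec_eq_iff matrix_matrix_mult_def sum_distrib_left mult_ac)

lemma scale_mat_mult_vec: "(c *\<^sub>M A) *v x = c *s (A *v x)"
  and matrix_vector_mult_smult: "A *v (c *s x) = c *s (A *v x)"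
  by (simp_all add: vec_eq_iff matrix_vector_mult_def sum_distrib_left mult_ac)

lemma matrix_add_rdistrib: "(A + B) ** C = A ** C + B ** (C :: 'a::comm_ring_1 ^ _ ^ _)"
  by (simp add: vec_eq_iff matrix_matrix_mult_def algebra_simps sum.distrib)

section \<open>The symplectic form\<close>

lemma symp_form_add_left: "symp_form (u + v) w = symp_form u w + symp_form v w"
  and symp_form_add_right: "symp_form w (u + v) = symp_form w u + symp_form w v"
  by (simp_all add: symp_form_def algebra_simps flip: sum.distrib)

lemma symp_form_diff_left: "symp_form (u - v) w = symp_form u w - symp_form v w"
  and symp_form_diff_right: "symp_form w (u - v) = symp_form w u - symp_form w v"
  by (simp_all add: symp_form_def algebra_simps flip: sum_subtractf sum.distrib)

lemma symp_form_smult_left: "symp_form (c *s v) w = c * symp_form v w"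
  and symp_form_smult_right: "symp_form v (c *s w) = c * symp_form v w"
  by (simp_all add: symp_form_def algebra_simps sum_distrib_left)

lemma symp_form_self [simp]: "symp_form v v = 0"
  by (simp add: symp_form_def algebra_simps)

lemma symp_form_skew: "symp_form w v = - symp_form v w"
  by (simp add: symp_form_def algebra_simps flip: sum_negf)

lemma symp_form_zero_left [simp]: "symp_form 0 w = 0"
  and symp_form_zero_right [simp]: "symp_form w 0 = 0"
  by (simp_all add: symp_form_def)

lemma symp_form_sum_left: "symp_form (\<Sum>i\<in>A. f i) w = (\<Sum>i\<in>A. symp_form (f i) w)"
  and symp_form_sum_right: "symp_form w (\<Sum>i\<in>A. f i) = (\<Sum>i\<in>A. symp_form w (f i))"
  by (induction A rule: infinite_finite_induct)
    (simp_all add: symp_form_add_left symp_form_add_right)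

lemmas symp_form_linear =
  symp_form_add_left symp_form_add_right symp_form_diff_left symp_form_diff_right
  symp_form_smult_left symp_form_smult_right

definition symp_dual :: "'g + 'g \<Rightarrow> 'a::comm_ring_1 ^ ('g::finite + 'g)"
  where "symp_dual j = (case j of Inl i \<Rightarrow> axis (Inr i) 1 | Inr i \<Rightarrow> axis (Inl i) (- 1))"

lemma symp_form_symp_dual_right [simp]: "symp_form v (symp_dual j) = v $ j"
  by (cases j)
    (simp_all add: symp_form_def symp_dual_def axis_def if_distrib[of "(*) _"] sum_negf
      cong: if_cong)

lemma symp_form_symp_dual_left [simp]: "symp_form (symp_dual j) v = - v $ j"
  by (simp add: symp_form_skew[of "symp_dual j"])

lemma symp_form_eqI:
  assumes "\<And>w. symp_form w u = symp_form w v"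
  shows "u = v"
  using assms[of "symp_dual _"] by (simp add: vec_eq_iff)

lemma symp_dual_expansion: "(\<Sum>j\<in>UNIV. symp_form (axis j 1) x *s symp_dual j) = x"
proof (rule symp_form_eqI)
  fix w
  have "symp_form w (\<Sum>j\<in>UNIV. symp_form (axis j 1) x *s symp_dual j) =
      symp_form (\<Sum>j\<in>UNIV. w $ j *s axis j 1) x"
    by (simp add: symp_form_sum_left symp_form_sum_right symp_form_linear mult_ac)
  then show "symp_form w (\<Sum>j\<in>UNIV. symp_form (axis j 1) x *s symp_dual j) = symp_form w x"
    by (simp add: basis_expansion)
qed

section \<open>Symplectic similitudes over a commutative ring\<close>

lemma is_multiplier_mult:
  "is_multiplier S c \<Longrightarrow> is_multiplier S' c' \<Longrightarrow> is_multiplier (S ** S') (c * c')"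
  by (simp add: is_multiplier_def mult.assoc flip: matrix_vector_mul_assoc)

lemma is_multiplier_one [simp]: "is_multiplier (mat 1) 1"
  by (simp add: is_multiplier_def)

lemma is_multiplier_inverse:
  assumes "S ** S' = mat 1" "is_multiplier S c" "c * d = 1"
  shows "is_multiplier S' d"
  unfolding is_multiplier_def
proof (intro allI)
  fix v w
  have "symp_form v w = symp_form (S *v (S' *v v)) (S *v (S' *v w))"
    using assms(1) by (simp add: matrix_vector_mul_assoc)
  also have "\<dots> = c * symp_form (S' *v v) (S' *v w)"
    using assms(2) by (simp add: is_multiplier_def)
  finally have "d * symp_form v w = (c * d) * symp_form (S' *v v) (S' *v w)"
    by (simp add: mult_ac)
  then show "symp_form (S' *v v) (S' *v w) = d * symp_form v w"
    using assms(3) by simp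
qed

lemma is_multiplier_imp_eq:
  fixes S :: "'a::comm_ring_1 ^ ('g::finite + 'g) ^ ('g + 'g)"
  assumes "is_multiplier S c"
  shows "c = symp_form (S *v axis i 1) (S *v symp_dual i)"
  using assms by (simp add: is_multiplier_def)

lemma multiplier_eqI: "is_multiplier S c \<Longrightarrow> multiplier S = c"
  unfolding multiplier_def using is_multiplier_imp_eq by (metis the_equality)

lemma mult_GSp [simp]: "(\<otimes>\<^bsub>GSp\<^esub>) = (**)"
  and one_GSp [simp]: "\<one>\<^bsub>GSp\<^esub> = mat 1"
  by (simp_all add: GSp_def)

lemma carrier_GSpI:
  "S ** S' = mat 1 \<Longrightarrow> S' ** S = mat 1 \<Longrightarrow> is_multiplier S c \<Longrightarrow> c dvd 1 \<Longrightarrow> S \<in> carrier GSp"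
  by (auto simp: GSp_def invertible_def)

lemma carrier_GSpE:
  assumes "S \<in> carrier GSp"
  obtains S' c d where "S ** S' = mat 1" "S' ** S = mat 1"
    and "is_multiplier S c" "is_multiplier S' d" "c * d = 1"
proof -
  obtain S' c where inverse: "S ** S' = mat 1" "S' ** S = mat 1"
    and c: "is_multiplier S c" "c dvd 1"
    using assms by (auto simp: GSp_def invertible_def)
  obtain d where d: "c * d = 1" using c(2) by (metis dvdE)
  show thesis by (rule that[OF inverse c(1) is_multiplier_inverse[OF inverse(1) c(1) d] d])
qed

lemma is_multiplier_multiplier: "S \<in> carrier GSp \<Longrightarrow> is_multiplier S (multiplier S)"
  by (metis carrier_GSpE multiplier_eqI)

lemma multiplier_unit: "S \<in> carrier GSp \<Longrightarrow> multiplier S dvd 1"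
  by (metis carrier_GSpE multiplier_eqI dvd_triv_left)

lemma carrier_Sp_iff: "S \<in> carrier Sp \<longleftrightarrow> S \<in> carrier GSp \<and> multiplier S = 1"
proof
  assume "S \<in> carrier Sp"
  then show "S \<in> carrier GSp \<and> multiplier S = 1"
    using multiplier_eqI[of S 1] by (auto simp: Sp_def GSp_def intro!: exI[of _ 1])
next
  assume "S \<in> carrier GSp \<and> multiplier S = 1"
  then show "S \<in> carrier Sp"
    using is_multiplier_multiplier[of S] by (auto simp: Sp_def GSp_def)
qed

lemma group_GSp: "group (GSp :: ('a::comm_ring_1 ^ ('g::finite + 'g) ^ ('g + 'g)) monoid)"
proof (rule groupI)
  fix x y :: "'a ^ ('g + 'g) ^ ('g + 'g)"
  assume "x \<in> carrier GSp" "y \<in> carrier GSp"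
  then obtain x' c d y' c' d'
    where x: "x ** x' = mat 1" "x' ** x = mat 1" "is_multiplier x c" "c * d = 1"
      and y: "y ** y' = mat 1" "y' ** y = mat 1" "is_multiplier y c'" "c' * d' = 1"
    by (elim carrier_GSpE)
  have "x ** y ** (y' ** x') = x ** (y ** y') ** x'" "y' ** x' ** (x ** y) = y' ** (x' ** x) ** y"
    by (simp_all add: matrix_mul_assoc)
  then show "x \<otimes>\<^bsub>GSp\<^esub> y \<in> carrier GSp"
    using x y is_multiplier_mult[OF x(3) y(3)] mult_dvd_mono[of c 1 c' 1]
    by (auto intro!: carrier_GSpI[of "x ** y" "y' ** x'" "c * c'"] simp: dvdI)
next
  fix x :: "'a ^ ('g + 'g) ^ ('g + 'g)"
  assume "x \<in> carrier GSp"
  then obtain x' c d where x: "x ** x' = mat 1" "x' ** x = mat 1" "is_multiplier x' d" "c * d = 1"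
    by (rule carrier_GSpE)
  then have "x' \<in> carrier GSp"
    by (intro carrier_GSpI[of x' x d]) (simp_all add: dvdI[of 1 d c] mult.commute)
  then show "\<exists>y\<in>carrier GSp. y \<otimes>\<^bsub>GSp\<^esub> x = \<one>\<^bsub>GSp\<^esub>" using x by auto
next
  show "\<one>\<^bsub>GSp\<^esub> \<in> carrier (GSp :: ('a ^ ('g + 'g) ^ ('g + 'g)) monoid)"
    by (simp add: carrier_GSpI[of _ "mat 1" 1])
qed (simp_all add: matrix_mul_assoc)

interpretation GSp: group "GSp :: ('a::comm_ring_1 ^ ('g::finite + 'g) ^ ('g + 'g)) monoid"
  rewrites "(\<otimes>\<^bsub>GSp\<^esub>) = (**)" and "\<one>\<^bsub>GSp\<^esub> = mat 1"
  by (simp_all add: group_GSp)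

lemma multiplier_mult:
  "x \<in> carrier GSp \<Longrightarrow> y \<in> carrier GSp \<Longrightarrow> multiplier (x ** y) = multiplier x * multiplier y"
  by (intro multiplier_eqI is_multiplier_mult is_multiplier_multiplier)

definition is_infinitesimal_multiplier ::
    "'a::comm_ring_1 ^ ('g::finite + 'g) ^ ('g + 'g) \<Rightarrow> 'a \<Rightarrow> bool" where
  "is_infinitesimal_multiplier A \<mu> \<longleftrightarrow>
     (\<forall>v w. symp_form (A *v v) w + symp_form v (A *v w) = \<mu> * symp_form v w)"

lemma is_multiplier_one_plus_scale:
  "is_multiplier (mat 1 + c *\<^sub>M A) m \<longleftrightarrow>
    (\<forall>v w. c * (symp_form (A *v v) w + symp_form v (A *v w) + c * symp_form (A *v v) (A *v w)) =
      (m - 1) * symp_form v w)"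
  by (simp add: is_multiplier_def matrix_vector_mult_add_rdistrib scale_mat_mult_vec
      symp_form_linear algebra_simps)

section \<open>Transvections and diagonal similitudes\<close>

definition symp_tensor ::
    "'a::comm_ring_1 ^ ('g::finite + 'g) \<Rightarrow> 'a ^ ('g + 'g) \<Rightarrow> 'a ^ ('g + 'g) ^ ('g + 'g)"
  where "symp_tensor v w = (\<chi> i j. v $ i * symp_form w (axis j 1))"

lemma symp_tensor_mult_vec: "symp_tensor v w *v x = symp_form w x *s v"
proof -
  have "symp_form w x = (\<Sum>j\<in>UNIV. x $ j * symp_form w (axis j 1))"
    by (subst basis_expansion[of x, symmetric]) (simp add: symp_form_sum_right symp_form_linear)
  then show ?thesis
    by (simp add: vec_eq_iff symp_tensor_def matrix_vector_mult_def sum_distrib_left mult_ac)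
qed

lemma symp_tensor_add_left: "symp_tensor (u + v) w = symp_tensor u w + symp_tensor v w"
  and symp_tensor_add_right: "symp_tensor w (u + v) = symp_tensor w u + symp_tensor w v"
  and symp_tensor_smult_left: "symp_tensor (c *s v) w = c *\<^sub>M symp_tensor v w"
  and symp_tensor_smult_right: "symp_tensor v (c *s w) = c *\<^sub>M symp_tensor v w"
  by (simp_all add: symp_tensor_def vec_eq_iff symp_form_linear algebra_simps)

lemma symp_tensor_zero_left [simp]: "symp_tensor 0 w = 0"
  by (simp add: symp_tensor_def vec_eq_iff)

definition symp_sym_tensor ::
    "'a::comm_ring_1 ^ ('g::finite + 'g) \<Rightarrow> 'a ^ ('g + 'g) \<Rightarrow> 'a ^ ('g + 'g) ^ ('g + 'g)"
  where "symp_sym_tensor v w = symp_tensor v w + symp_tensor w v"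

lemma is_infinitesimal_multiplier_symp_tensor: "is_infinitesimal_multiplier (symp_tensor v v) 0"
  using symp_form_skew[of v]
  by (simp add: is_infinitesimal_multiplier_def symp_tensor_mult_vec symp_form_linear)

definition transvection ::
    "'a::comm_ring_1 \<Rightarrow> 'a ^ ('g::finite + 'g) \<Rightarrow> 'a ^ ('g + 'g) ^ ('g + 'g)"
  where "transvection c v = mat 1 + c *\<^sub>M symp_tensor v v"

lemma transvection_mult_vec: "transvection c v *v x = x + (c * symp_form v x) *s v"
  by (simp add: transvection_def matrix_vector_mult_add_rdistrib scale_mat_mult_vec
      symp_tensor_mult_vec vector_smult_assoc)

lemma is_multiplier_transvection: "is_multiplier (transvection c v) 1"
  using symp_form_skew[of v]
  by (simp add: is_multiplier_def transvection_mult_vec symp_form_linear algebra_simps)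

lemma transvection_inverse: "transvection c v ** transvection (- c) v = mat 1"
  by (simp add: matrix_eq transvection_mult_vec symp_form_linear vec_eq_iff algebra_simps
      flip: matrix_vector_mul_assoc)

lemma transvection_in_GSp: "transvection c v \<in> carrier GSp"
  using transvection_inverse[of c v] transvection_inverse[of "- c" v]
    is_multiplier_transvection[of c v]
  by (intro carrier_GSpI[of _ "transvection (- c) v" 1]) simp_all

lemma inv_transvection: "inv\<^bsub>GSp\<^esub> (transvection c v) = transvection (- c) v"
  using transvection_inverse[of "- c" v] transvection_in_GSp[of _ v]
  by (intro GSp.inv_equality) simp_all

lemma transvection_conj_diff:
  assumes "is_infinitesimal_multiplier A \<mu>"
  shows "transvection c w ** A ** transvection (- c) w - A =
    (c * \<mu> - c\<^sup>2 * symp_form w (A *v w)) *\<^sub>M symp_tensor w w - c *\<^sub>M symp_sym_tensor (A *v w) w"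
proof -
  have pair: "symp_form w (A *v x) = \<mu> * symp_form w x - symp_form (A *v w) x" for x
    using assms unfolding is_infinitesimal_multiplier_def by (metis add_diff_cancel_left')
  have "symp_form (A *v w) w = - symp_form w (A *v w)" by (rule symp_form_skew)
  then show ?thesis
    unfolding matrix_eq
    by (auto simp: symp_sym_tensor_def transvection_mult_vec symp_tensor_mult_vec scale_mat_mult_vec
        matrix_vector_mult_add_rdistrib matrix_vector_mult_diff_rdistrib matrix_vector_right_distrib
        matrix_vector_mult_smult symp_form_linear pair vec_eq_iff power2_eq_square algebra_simps
        simp flip: matrix_vector_mul_assoc)
qed

definition lagrangian_proj :: "'a::comm_ring_1 ^ ('g::finite + 'g) ^ ('g + 'g)"
  where "lagrangian_proj = (\<chi> i j. if i = j \<and> isl i then 1 else 0)"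

lemma lagrangian_proj_mult_vec_nth [simp]:
  "(lagrangian_proj *v x) $ Inl i = x $ Inl i"
  "(lagrangian_proj *v x) $ Inr i = 0"
  by (simp_all add: lagrangian_proj_def matrix_vector_mult_def if_distrib[of "\<lambda>x. x * _"]
      cong: if_cong)

lemma is_infinitesimal_multiplier_lagrangian_proj: "is_infinitesimal_multiplier lagrangian_proj 1"
  by (simp add: is_infinitesimal_multiplier_def symp_form_def algebra_simps flip: sum.distrib)

definition diag_similitude :: "'a::comm_ring_1 \<Rightarrow> 'a ^ ('g::finite + 'g) ^ ('g + 'g)"
  where "diag_similitude u = mat 1 + (u - 1) *\<^sub>M lagrangian_proj"

lemma diag_similitude_mult_vec_nth [simp]:
  "(diag_similitude u *v x) $ Inl i = u * x $ Inl i"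
  "(diag_similitude u *v x) $ Inr i = x $ Inr i"
  by (simp_all add: diag_similitude_def matrix_vector_mult_add_rdistrib scale_mat_mult_vec
      algebra_simps)

lemma is_multiplier_diag_similitude: "is_multiplier (diag_similitude u) u"
  by (simp add: is_multiplier_def symp_form_def sum_distrib_left algebra_simps)

lemma diag_similitude_mult: "diag_similitude u ** diag_similitude v = diag_similitude (u * v)"
  unfolding matrix_eq vec_eq_iff matrix_vector_mul_assoc[symmetric]
proof (intro allI)
  fix x i
  show "(diag_similitude u *v (diag_similitude v *v x)) $ i = (diag_similitude (u * v) *v x) $ i"
    by (cases i) (simp_all add: mult_ac)
qed

lemma diag_similitude_in_GSp:
  assumes "u dvd 1" shows "diag_similitude u \<in> carrier GSp"
proof -
  obtain v where "u * v = 1" using assms by (metis dvdE)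
  moreover have "diag_similitude 1 = mat 1" by (simp add: diag_similitude_def)
  ultimately show ?thesis
    using assms by (intro carrier_GSpI[of _ "diag_similitude v" u])
      (simp_all add: diag_similitude_mult is_multiplier_diag_similitude mult.commute)
qed

section \<open>Reduction and congruence of matrices\<close>

definition map_vector :: "('a \<Rightarrow> 'b) \<Rightarrow> 'a ^ 'n \<Rightarrow> 'b ^ 'n"
  where "map_vector f v = (\<chi> i. f (v $ i))"

lemma map_vector_nth [simp]: "map_vector f v $ i = f (v $ i)"
  by (simp add: map_vector_def)

context surj_ring_hom
begin

lemma map_matrix_add [simp]: "map_matrix f (A + B) = map_matrix f A + map_matrix f B"
  and map_matrix_minus [simp]: "map_matrix f (- A) = - map_matrix f A"
  and map_matrix_zero [simp]: "map_matrix f 0 = 0"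
  and map_matrix_scale [simp]: "map_matrix f (c *\<^sub>M A) = f c *\<^sub>M map_matrix f A"
  and map_matrix_one [simp]: "map_matrix f (mat 1) = mat 1"
  and map_matrix_mult [simp]: "map_matrix f (A ** B') = map_matrix f A ** map_matrix f B'"
  by (simp_all add: vec_eq_iff mat_def matrix_matrix_mult_def)

lemma map_vector_mult [simp]: "map_vector f (A *v x) = map_matrix f A *v map_vector f x"
  by (simp add: vec_eq_iff matrix_vector_mult_def)

lemma hom_symp_form [simp]: "f (symp_form v w) = symp_form (map_vector f v) (map_vector f w)"
  by (simp add: symp_form_def)

lemma map_matrix_symp_tensor [simp]:
  "map_matrix f (symp_tensor v w) = symp_tensor (map_vector f v) (map_vector f w)"
proof -
  have axis: "map_vector f (axis j 1) = axis j 1" for j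
    by (simp add: vec_eq_iff axis_def)
  show ?thesis by (simp add: vec_eq_iff symp_tensor_def axis)
qed

lemma map_matrix_lagrangian_proj [simp]: "map_matrix f lagrangian_proj = lagrangian_proj"
  by (simp add: vec_eq_iff lagrangian_proj_def)

lemma surj_map_vector: "surj (map_vector f)"
proof (rule surjI)
  show "map_vector f (\<chi> i. inv_into UNIV f (v $ i)) = v" for v
    by (simp add: vec_eq_iff surj_f_inv_f[OF surj])
qed

lemma is_multiplier_map_matrix:
  fixes S :: "'a ^ ('g::finite + 'g) ^ ('g + 'g)"
  assumes "is_multiplier S c"
  shows "is_multiplier (map_matrix f S) (f c)"
  unfolding is_multiplier_def
proof (intro allI)
  fix v w :: "'b ^ ('g + 'g)"
  obtain x y where lift: "v = map_vector f x" "w = map_vector f y"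
    using surj_map_vector by (metis surjD)
  have "f (symp_form (S *v x) (S *v y)) = f (c * symp_form x y)"
    using assms by (simp only: is_multiplier_def)
  then show "symp_form (map_matrix f S *v v) (map_matrix f S *v w) = f c * symp_form v w"
    by (simp add: lift)
qed

lemma map_matrix_in_GSp:
  assumes "S \<in> carrier GSp"
  shows "map_matrix f S \<in> carrier GSp"
proof -
  obtain S' c d where S: "S ** S' = mat 1" "S' ** S = mat 1" "is_multiplier S c" "c * d = 1"
    using assms by (rule carrier_GSpE)
  show ?thesis
  proof (rule carrier_GSpI)
    show "map_matrix f S ** map_matrix f S' = mat 1" "map_matrix f S' ** map_matrix f S = mat 1"
      using S(1,2) by (metis map_matrix_mult map_matrix_one)+
    show "is_multiplier (map_matrix f S) (f c)" using S(3) by (rule is_multiplier_map_matrix)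
    show "f c dvd 1" using S(4) by (intro hom_dvd_one dvdI) simp
  qed
qed

lemma map_matrix_group_hom:
  "group_hom GSp GSp (map_matrix f :: 'a ^ ('g::finite + 'g) ^ ('g + 'g) \<Rightarrow> _)"
  using map_matrix_in_GSp
  by (auto simp: group_hom_def group_hom_axioms_def group_GSp hom_def)

end

definition mat_cong :: "'a::comm_ring_1 \<Rightarrow> 'a ^ 'n ^ 'm \<Rightarrow> 'a ^ 'n ^ 'm \<Rightarrow> bool"
  where "mat_cong d X Y \<longleftrightarrow> (\<forall>i j. d dvd X $ i $ j - Y $ i $ j)"

lemma mat_cong_refl [simp]: "mat_cong d X X"
  by (simp add: mat_cong_def)

lemma mat_cong_sym: "mat_cong d X Y \<Longrightarrow> mat_cong d Y X"
  unfolding mat_cong_def by (metis dvd_minus_iff minus_diff_eq)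

lemma mat_cong_iff_scale_mat: "mat_cong d X Y \<longleftrightarrow> (\<exists>Z. X = Y + d *\<^sub>M Z)"
proof
  assume "mat_cong d X Y"
  then have "\<forall>i j. \<exists>z. X $ i $ j - Y $ i $ j = d * z" by (simp add: mat_cong_def dvd_def)
  then obtain Z where Z: "\<And>i j. X $ i $ j - Y $ i $ j = d * Z i j" by metis
  then have "X = Y + d *\<^sub>M (\<chi> i j. Z i j)" by (simp add: vec_eq_iff flip: Z)
  then show "\<exists>Z. X = Y + d *\<^sub>M Z" by blast
qed (auto simp: mat_cong_def)

lemma mat_cong_mult:
  assumes "mat_cong d X X'" "mat_cong d Y Y'"
  shows "mat_cong d (X ** Y) (X' ** Y')"
proof -
  obtain A B where "X = X' + d *\<^sub>M A" "Y = Y' + d *\<^sub>M B"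
    using assms by (auto simp: mat_cong_iff_scale_mat)
  then have "X ** Y = X' ** Y' + d *\<^sub>M (X' ** B + A ** Y)"
    by (simp add: matrix_add_rdistrib matrix_add_ldistrib scale_mat_mult_left
        scale_mat_mult_right matrix_space.scale_right_distrib add_ac)
  then show ?thesis unfolding mat_cong_iff_scale_mat by blast
qed

lemma multiplier_cong:
  fixes X Y :: "'a::comm_ring_1 ^ ('g::finite + 'g) ^ ('g + 'g)"
  assumes "X \<in> carrier GSp" "Y \<in> carrier GSp" "mat_cong d X Y"
  shows "d dvd multiplier X - multiplier Y"
proof -
  define i :: "'g + 'g" where "i = undefined"
  define x y :: "'a ^ ('g + 'g)" where "x = axis i 1" and "y = symp_dual i"
  obtain Z where Z: "X = Y + d *\<^sub>M Z" using assms(3) by (auto simp: mat_cong_iff_scale_mat)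
  have "multiplier X - multiplier Y = symp_form (X *v x) (X *v y) - symp_form (Y *v x) (Y *v y)"
    using assms(1,2) unfolding x_def y_def
    by (simp flip: is_multiplier_imp_eq[OF is_multiplier_multiplier])
  also have "\<dots> = d * (symp_form (Z *v x) (X *v y) + symp_form (Y *v x) (Z *v y))"
    by (simp add: Z matrix_vector_mult_add_rdistrib scale_mat_mult_vec symp_form_linear
        algebra_simps)
  finally show ?thesis by simp
qed

section \<open>Topologies given by congruences\<close>

locale congruence_topology =
  fixes R :: "nat \<Rightarrow> 'a::topological_space \<Rightarrow> 'a \<Rightarrow> bool"
  assumes refl [simp]: "R n x x"
    and trans: "R n x y \<Longrightarrow> R n y z \<Longrightarrow> R n x z"
    and mono: "R n x y \<Longrightarrow> m \<le> n \<Longrightarrow> R m x y"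
    and open_iff: "open U \<longleftrightarrow> (\<forall>x\<in>U. \<exists>n. \<forall>y. R n y x \<longrightarrow> y \<in> U)"
begin

lemma open_class: "open {y. R n y x}"
  unfolding open_iff using trans by blast

lemma openin_iff:
  "openin (top_of_set S) U \<longleftrightarrow> U \<subseteq> S \<and> (\<forall>x\<in>U. \<exists>n. \<forall>y\<in>S. R n y x \<longrightarrow> y \<in> U)"
proof
  assume "openin (top_of_set S) U"
  then obtain W where "open W" "U = S \<inter> W" by (auto simp: openin_open)
  then show "U \<subseteq> S \<and> (\<forall>x\<in>U. \<exists>n. \<forall>y\<in>S. R n y x \<longrightarrow> y \<in> U)"
    unfolding open_iff by blast
next
  assume U: "U \<subseteq> S \<and> (\<forall>x\<in>U. \<exists>n. \<forall>y\<in>S. R n y x \<longrightarrow> y \<in> U)"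
  then obtain N where N: "\<And>x y. x \<in> U \<Longrightarrow> y \<in> S \<Longrightarrow> R (N x) y x \<Longrightarrow> y \<in> U" by metis
  have "open (\<Union>x\<in>U. {y. R (N x) y x})"
    by (intro open_UN ballI open_class)
  moreover have "U = S \<inter> (\<Union>x\<in>U. {y. R (N x) y x})"
    using U N by auto
  ultimately show "openin (top_of_set S) U" unfolding openin_open by blast
qed

lemma in_closure_of_iff:
  assumes "A \<subseteq> S"
  shows "x \<in> top_of_set S closure_of A \<longleftrightarrow> x \<in> S \<and> (\<forall>n. \<exists>y\<in>A. R n y x)"
proof -
  have "(\<forall>n. \<exists>y\<in>A. R n y x) \<longleftrightarrow> (\<forall>U. x \<in> U \<and> open U \<longrightarrow> (\<exists>y\<in>A. y \<in> U))"
  proof (intro iffI allI impI)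
    fix U assume "\<forall>n. \<exists>y\<in>A. R n y x" "x \<in> U \<and> open U"
    then show "\<exists>y\<in>A. y \<in> U" unfolding open_iff by blast
  next
    fix n assume dense: "\<forall>U. x \<in> U \<and> open U \<longrightarrow> (\<exists>y\<in>A. y \<in> U)"
    show "\<exists>y\<in>A. R n y x"
      using dense[rule_format, of "{y. R n y x}"] open_class[of n x] by simp
  qed
  then show ?thesis
    using in_closure_of[of x euclidean A]
    by (simp add: closure_of_subtopology Int_absorb1[OF assms] Bex_def)
qed

lemma continuous_map_discreteI:
  assumes "f ` S \<subseteq> D" "\<And>x. x \<in> S \<Longrightarrow> \<exists>n. \<forall>y\<in>S. R n y x \<longrightarrow> f y = f x"
  shows "continuous_map (top_of_set S) (discrete_topology D) f"
  unfolding continuous_map openin_iff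
proof (intro conjI allI impI ballI)
  fix U x assume x: "x \<in> {x \<in> topspace (top_of_set S). f x \<in> U}"
  then have "x \<in> S" by simp
  then obtain n where n: "\<And>y. y \<in> S \<Longrightarrow> R n y x \<Longrightarrow> f y = f x" using assms(2) by blast
  have "y \<in> {x \<in> topspace (top_of_set S). f x \<in> U}" if "y \<in> S" "R n y x" for y
    using n[OF that] that x by simp
  then show "\<exists>n. \<forall>y\<in>S. R n y x \<longrightarrow> y \<in> {x \<in> topspace (top_of_set S). f x \<in> U}" by blast
qed (use assms(1) in auto)

end

lemma continuous_map_congruence_topologyI:
  assumes "congruence_topology R" "congruence_topology R'" "f ` S \<subseteq> T"
    and cong: "\<And>x n. x \<in> S \<Longrightarrow> \<exists>m. \<forall>y\<in>S. R m y x \<longrightarrow> R' n (f y) (f x)"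
  shows "continuous_map (top_of_set S) (top_of_set T) f"
proof -
  interpret source: congruence_topology R by fact
  interpret target: congruence_topology R' by fact
  show ?thesis
    unfolding continuous_map source.openin_iff target.openin_iff
  proof (intro conjI allI impI ballI)
    fix U x
    assume U: "U \<subseteq> T \<and> (\<forall>x\<in>U. \<exists>n. \<forall>y\<in>T. R' n y x \<longrightarrow> y \<in> U)"
      and x: "x \<in> {x \<in> topspace (top_of_set S). f x \<in> U}"
    then obtain n where "\<And>y. y \<in> T \<Longrightarrow> R' n y (f x) \<Longrightarrow> y \<in> U" by blast
    moreover obtain m where "\<And>y. y \<in> S \<Longrightarrow> R m y x \<Longrightarrow> R' n (f y) (f x)"
      using cong[of x n] x by auto
    ultimately show "\<exists>m. \<forall>y\<in>S. R m y x \<longrightarrow> y \<in> {x \<in> topspace (top_of_set S). f x \<in> U}"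
      using assms(3) by (intro exI[of _ m]) auto
  qed (use assms(3) in auto)
qed

lemma congruence_topology_vec:
  fixes R :: "nat \<Rightarrow> 'a::topological_space \<Rightarrow> 'a \<Rightarrow> bool"
  assumes "congruence_topology R"
  shows "congruence_topology (\<lambda>n x y :: 'a ^ 'n. \<forall>i. R n (x $ i) (y $ i))"
proof -
  interpret congruence_topology R by fact
  show ?thesis
  proof
    fix U :: "('a ^ 'n) set"
    show "open U \<longleftrightarrow> (\<forall>x\<in>U. \<exists>n. \<forall>y. (\<forall>i. R n (y $ i) (x $ i)) \<longrightarrow> y \<in> U)"
    proof (intro iffI ballI)
      fix x assume "open U" "x \<in> U"
      then obtain A where A: "\<And>i. open (A i)" "\<And>i. x $ i \<in> A i" "\<And>y. (\<forall>i. y $ i \<in> A i) \<Longrightarrow> y \<in> U"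
        unfolding open_vec_def by metis
      then have "\<forall>i. \<exists>n. \<forall>y. R n y (x $ i) \<longrightarrow> y \<in> A i" unfolding open_iff by blast
      then obtain N where N: "\<And>i y. R (N i) y (x $ i) \<Longrightarrow> y \<in> A i" by metis
      have "N i \<le> Max (range N)" for i by simp
      then have "\<forall>y. (\<forall>i. R (Max (range N)) (y $ i) (x $ i)) \<longrightarrow> y \<in> U"
        using A(3) N mono by blast
      then show "\<exists>n. \<forall>y. (\<forall>i. R n (y $ i) (x $ i)) \<longrightarrow> y \<in> U" by blast
    next
      assume U: "\<forall>x\<in>U. \<exists>n. \<forall>y. (\<forall>i. R n (y $ i) (x $ i)) \<longrightarrow> y \<in> U"
      show "open U"
        unfolding open_vec_def[of U]
      proof
        fix x assume "x \<in> U"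
        then obtain n where n: "\<And>y. \<forall>i. R n (y $ i) (x $ i) \<Longrightarrow> y \<in> U" using U by blast
        then show "\<exists>A. (\<forall>i. open (A i) \<and> x $ i \<in> A i) \<and> (\<forall>y. (\<forall>i. y $ i \<in> A i) \<longrightarrow> y \<in> U)"
          using open_class[of n] by (intro exI[of _ "\<lambda>i. {y. R n y (x $ i)}"]) simp
      qed
    qed
  qed (auto intro: trans mono)
qed

lemma congruence_topology_z2adic: "congruence_topology (\<lambda>n x y :: z2adic. 2 ^ n dvd x - y)"
proof
  fix n :: nat and x y z :: z2adic
  assume "2 ^ n dvd x - y"
  moreover assume "2 ^ n dvd y - z"
  ultimately show "2 ^ n dvd x - z" using dvd_add by fastforce
next
  fix m n :: nat and x y :: z2adic
  assume "2 ^ n dvd x - y" "m \<le> n"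
  then show "2 ^ m dvd x - y" by (meson dvd_trans le_imp_power_dvd)
next
  fix U :: "z2adic set"
  show "open U \<longleftrightarrow> (\<forall>x\<in>U. \<exists>n. \<forall>y. 2 ^ n dvd y - x \<longrightarrow> y \<in> U)"
    unfolding open_z2adic_def residue_at_eq_iff ..
qed simp

interpretation mat_cong: congruence_topology "\<lambda>n. mat_cong (2 ^ n :: z2adic)"
  using congruence_topology_vec[OF congruence_topology_vec[OF congruence_topology_z2adic]]
  unfolding mat_cong_def .

section \<open>The congruence filtration\<close>

context surj_ring_hom
begin

text \<open>\<open>A\<close> is the class of \<open>k\<close> in the quotient of the congruence subgroups of levels \<open>d\<close> and \<open>d p\<close>,
  where \<open>p\<close> generates the kernel of \<open>f\<close>.\<close>

definition graded_class :: "'a \<Rightarrow> 'a ^ 'n ^ 'n \<Rightarrow> 'b ^ 'n ^ 'n \<Rightarrow> bool"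
  where "graded_class d k A \<longleftrightarrow> (\<exists>Z. k = mat 1 + d *\<^sub>M Z \<and> map_matrix f Z = A)"

lemma graded_classI: "graded_class d (mat 1 + d *\<^sub>M Z) (map_matrix f Z)"
  by (auto simp: graded_class_def)

lemma graded_class_one: "graded_class d (mat 1) 0"
  using graded_classI[of d 0] by simp

lemma mat_cong_one_iff: "mat_cong d k (mat 1) \<longleftrightarrow> (\<exists>A. graded_class d k A)"
  by (auto simp: mat_cong_iff_scale_mat graded_class_def)

lemma graded_class_map_matrix: "graded_class d k A \<Longrightarrow> f d = 0 \<Longrightarrow> map_matrix f k = mat 1"
  by (auto simp: graded_class_def)

lemma graded_class_mult:
  assumes "graded_class d k A" "graded_class d k' A'" "f d = 0"
  shows "graded_class d (k ** k') (A + A')"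
proof -
  obtain Z Z' where Z: "k = mat 1 + d *\<^sub>M Z" "map_matrix f Z = A"
    and Z': "k' = mat 1 + d *\<^sub>M Z'" "map_matrix f Z' = A'"
    using assms(1,2) by (auto simp: graded_class_def)
  have "k ** k' = mat 1 + d *\<^sub>M (Z ** k' + Z')"
    by (simp add: Z(1) Z'(1) matrix_add_rdistrib scale_mat_mult_left
        matrix_space.scale_right_distrib add_ac)
  moreover have "map_matrix f (Z ** k' + Z') = A + A'"
    using graded_class_map_matrix[OF assms(2,3)] Z(2) Z'(2) by simp
  ultimately show ?thesis by (metis graded_classI)
qed

lemma graded_class_inverse:
  assumes "graded_class d k A" "k ** k' = mat 1" "f d = 0"
  shows "graded_class d k' (- A)"
proof -
  obtain Z where Z: "k = mat 1 + d *\<^sub>M Z" "map_matrix f Z = A"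
    using assms(1) by (auto simp: graded_class_def)
  have "k' + d *\<^sub>M (Z ** k') = mat 1"
    using assms(2) by (simp add: Z(1) matrix_add_rdistrib scale_mat_mult_left)
  then have "k' = mat 1 + d *\<^sub>M (- (Z ** k'))"
    by (simp add: eq_diff_eq)
  moreover have "map_matrix f k' = mat 1"
    using graded_class_map_matrix[OF assms(1,3)] arg_cong[OF assms(2), of "map_matrix f"] by simp
  then have "map_matrix f (- (Z ** k')) = - A" by (simp add: Z(2))
  ultimately show ?thesis by (metis graded_classI)
qed

lemma graded_class_conj:
  assumes "graded_class d k A" "h ** h' = mat 1"
  shows "graded_class d (h ** k ** h') (map_matrix f h ** A ** map_matrix f h')"
proof -
  obtain Z where Z: "k = mat 1 + d *\<^sub>M Z" "map_matrix f Z = A"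
    using assms(1) by (auto simp: graded_class_def)
  have "h ** k ** h' = mat 1 + d *\<^sub>M (h ** Z ** h')"
    using assms(2) by (simp add: Z(1) matrix_add_rdistrib matrix_add_ldistrib
        scale_mat_mult_left scale_mat_mult_right)
  then show ?thesis using graded_classI[of d "h ** Z ** h'"] Z(2) by simp
qed

lemma graded_class_zero:
  assumes "graded_class d k 0" and ker: "\<And>x. f x = 0 \<Longrightarrow> p dvd x"
  shows "mat_cong (d * p) k (mat 1)"
proof -
  obtain Z where Z: "k = mat 1 + d *\<^sub>M Z" "map_matrix f Z = 0"
    using assms(1) by (auto simp: graded_class_def)
  then have "p dvd Z $ i $ j" for i j
    by (intro ker) (metis nth_map_matrix zero_index)
  then show ?thesis by (simp add: Z(1) mat_cong_def mult_dvd_mono)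
qed

lemma graded_class_transvection:
  "graded_class d (transvection d v) (symp_tensor (map_vector f v) (map_vector f v))"
  using graded_classI[of d "symp_tensor v v"] by (simp add: transvection_def)

lemma graded_class_diag_similitude: "graded_class d (diag_similitude (1 + d)) lagrangian_proj"
  using graded_classI[of d lagrangian_proj] by (simp add: diag_similitude_def)

lemma graded_class_infinitesimal_multiplier:
  fixes k :: "'a ^ ('g::finite + 'g) ^ ('g + 'g)"
  assumes "graded_class d k A" "is_multiplier k (1 + d * m)" "f d = 0"
    and cancel: "\<And>x y. d * x = d * y \<Longrightarrow> x = y"
  shows "is_infinitesimal_multiplier A (f m)"
  unfolding is_infinitesimal_multiplier_def
proof (intro allI)
  fix v w :: "'b ^ ('g + 'g)"
  obtain x y where lift: "v = map_vector f x" "w = map_vector f y"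
    using surj_map_vector by (metis surjD)
  obtain Z where Z: "k = mat 1 + d *\<^sub>M Z" "map_matrix f Z = A"
    using assms(1) by (auto simp: graded_class_def)
  have "d * (symp_form (Z *v x) y + symp_form x (Z *v y) + d * symp_form (Z *v x) (Z *v y)) =
      d * (m * symp_form x y)"
    using assms(2) by (simp add: Z(1) is_multiplier_one_plus_scale mult.assoc)
  then have "f (symp_form (Z *v x) y + symp_form x (Z *v y) + d * symp_form (Z *v x) (Z *v y)) =
      f (m * symp_form x y)"
    by (rule arg_cong[OF cancel])
  then show "symp_form (A *v v) w + symp_form v (A *v w) = f m * symp_form v w"
    using assms(3) Z(2) by (simp add: lift)
qed

end

section \<open>Generating the symplectic Lie algebra\<close>

lemma (in module) symmetric_double_sum_mem:
  assumes "subspace M" "finite I" "\<And>i. F i i \<in> M" "\<And>i j. F i j + F j i \<in> M"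
  shows "(\<Sum>i\<in>I. \<Sum>j\<in>I. F i j) \<in> M"
  using assms(2)
proof induction
  case empty
  show ?case by (simp add: subspace_0 assms(1))
next
  case (insert a I)
  have "(\<Sum>i\<in>insert a I. \<Sum>j\<in>insert a I. F i j) =
      F a a + (\<Sum>i\<in>I. F a i + F i a) + (\<Sum>i\<in>I. \<Sum>j\<in>I. F i j)"
    using insert by (simp add: sum.distrib add_ac)
  also have "\<dots> \<in> M"
    by (intro subspace_add[OF assms(1)] subspace_sum[OF assms(1)] assms insert.IH)
  finally show ?case .
qed

lemma matrix_eq_sum_symp_tensor:
  fixes A :: "'a::comm_ring_1 ^ ('g::finite + 'g) ^ ('g + 'g)"
  shows "A = (\<Sum>j\<in>UNIV. \<Sum>i\<in>UNIV.
    (A *v symp_dual j) $ i *\<^sub>M symp_tensor (axis i 1) (axis j 1))"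
proof -
  interpret additive "(*v) A"
    by unfold_locales (rule matrix_vector_right_distrib)
  define pairing :: "'g + 'g \<Rightarrow> 'g + 'g \<Rightarrow> 'a"
    where "pairing j k = symp_form (axis j 1) (axis k 1)" for j k
  have "A $ i $ k = (\<Sum>j\<in>UNIV. (A *v symp_dual j) $ i * pairing j k)" for i k
  proof -
    have "A $ i $ k = (A *v axis k 1) $ i"
      by (simp add: matrix_vector_mult_def axis_def if_distrib[of "(*) _"] cong: if_cong)
    also have "axis k 1 = (\<Sum>j\<in>UNIV. pairing j k *s symp_dual j)"
      by (simp add: pairing_def symp_dual_expansion)
    finally show ?thesis by (simp add: sum matrix_vector_mult_smult mult.commute)
  qed
  moreover have "symp_tensor (axis i 1) (axis j 1) $ m $ k = (if m = i then pairing j k else 0)"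
    for i j m k
    by (simp add: symp_tensor_def pairing_def) (simp add: axis_def)
  ultimately show ?thesis
    by (simp add: vec_eq_iff if_distrib[of "(*) _"] cong: if_cong)
qed

lemma symp_sym_tensor_polarization:
  "symp_sym_tensor v w = symp_tensor (v + w) (v + w) - symp_tensor v v - symp_tensor w w"
  by (simp add: symp_sym_tensor_def symp_tensor_add_left symp_tensor_add_right)

lemma infinitesimal_symplectic_in_span:
  fixes A :: "'a::comm_ring_1 ^ ('g::finite + 'g) ^ ('g + 'g)"
  assumes "is_infinitesimal_multiplier A 0"
  shows "A \<in> matrix_space.span (range (\<lambda>v. symp_tensor v v))"
proof -
  define a where "a i j = (A *v symp_dual j) $ i" for i j
  define e_tensor :: "'g + 'g \<Rightarrow> 'g + 'g \<Rightarrow> 'a ^ ('g + 'g) ^ ('g + 'g)"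
    where "e_tensor i j = symp_tensor (axis i 1) (axis j 1)" for i j
  let ?S = "matrix_space.span (range (\<lambda>v :: 'a ^ ('g + 'g). symp_tensor v v))"
  have square: "symp_tensor v v \<in> ?S" for v :: "'a ^ ('g + 'g)"
    by (simp add: matrix_space.span_base)
  have symmetric: "a j i = a i j" for i j
  proof -
    have "symp_form (A *v symp_dual j) (symp_dual i) + symp_form (symp_dual j) (A *v symp_dual i) =
        0 * symp_form (symp_dual j) (symp_dual i)"
      using assms unfolding is_infinitesimal_multiplier_def by blast
    then show ?thesis by (simp add: a_def)
  qed
  have "A = (\<Sum>j\<in>UNIV. \<Sum>i\<in>UNIV. a i j *\<^sub>M e_tensor i j)"
    unfolding a_def e_tensor_def by (rule matrix_eq_sum_symp_tensor)
  also have "\<dots> \<in> ?S"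
  proof (rule matrix_space.symmetric_double_sum_mem)
    fix i j :: "'g + 'g"
    show "a i i *\<^sub>M e_tensor i i \<in> ?S"
      unfolding e_tensor_def by (intro matrix_space.span_scale square)
    have "a i j *\<^sub>M e_tensor i j + a j i *\<^sub>M e_tensor j i =
        a i j *\<^sub>M symp_sym_tensor (axis i 1) (axis j 1)"
      by (simp add: symmetric e_tensor_def symp_sym_tensor_def matrix_space.scale_right_distrib)
    also have "\<dots> \<in> ?S"
      unfolding symp_sym_tensor_polarization
      by (intro matrix_space.span_scale matrix_space.span_diff square)
    finally show "a i j *\<^sub>M e_tensor i j + a j i *\<^sub>M e_tensor j i \<in> ?S" .
  qed simp_all
  finally show ?thesis .
qed

lemma symp_sym_tensor_commute: "symp_sym_tensor v w = symp_sym_tensor w v"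
  by (simp add: symp_sym_tensor_def add.commute)

lemma symp_sym_tensor_add_left:
    "symp_sym_tensor (u + v) w = symp_sym_tensor u w + symp_sym_tensor v w"
  and symp_sym_tensor_smult_left: "symp_sym_tensor (c *s v) w = c *\<^sub>M symp_sym_tensor v w"
  and symp_sym_tensor_zero_left [simp]: "symp_sym_tensor 0 w = 0"
  by (simp_all add: symp_sym_tensor_def symp_tensor_def vec_eq_iff symp_form_linear algebra_simps)

lemma subspace_symp_sym_tensor:
  fixes M :: "('a::field ^ ('g::finite + 'g) ^ ('g + 'g)) set"
  assumes "matrix_space.subspace M"
  shows "vec.subspace {v. symp_sym_tensor v w \<in> M}"
  by (rule vec.subspaceI)
    (simp_all add: assms matrix_space.subspace_0 matrix_space.subspace_add
      matrix_space.subspace_scale symp_sym_tensor_add_left symp_sym_tensor_smult_left)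

lemma subspace_symp_tensor_self:
  fixes M :: "('a::field ^ ('g::finite + 'g) ^ ('g + 'g)) set"
  assumes M: "matrix_space.subspace M" and sym: "\<And>v w. symp_sym_tensor v w \<in> M"
  shows "vec.subspace {v. symp_tensor v v \<in> M}"
proof (rule vec.subspaceI)
  show "0 \<in> {v. symp_tensor v v \<in> M}"
    by (simp add: matrix_space.subspace_0[OF M])
next
  fix u v assume "u \<in> {v. symp_tensor v v \<in> M}" "v \<in> {v. symp_tensor v v \<in> M}"
  then have "symp_sym_tensor u v + symp_tensor v v + symp_tensor u u \<in> M"
    using sym by (intro matrix_space.subspace_add[OF M]) simp_all
  then show "u + v \<in> {v. symp_tensor v v \<in> M}"
    by (simp add: symp_sym_tensor_polarization)
qed (simp add: symp_tensor_smult_left symp_tensor_smult_right matrix_space.subspace_scale[OF M])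

lemma infinitesimal_symplectic_mem_subspace:
  fixes B :: "('a::field ^ ('g::finite + 'g)) set"
  assumes M: "matrix_space.subspace M" and B: "vec.span B = UNIV"
    and square: "\<And>w. w \<in> B \<Longrightarrow> symp_tensor w w \<in> M"
    and sym: "\<And>v w. w \<in> B \<Longrightarrow> symp_sym_tensor v w \<in> M"
    and A: "is_infinitesimal_multiplier A 0"
  shows "A \<in> M"
proof -
  have "vec.span B \<subseteq> {v. symp_sym_tensor v w \<in> M}" for w
    using sym by (intro vec.span_minimal subspace_symp_sym_tensor[OF M])
      (auto simp: symp_sym_tensor_commute[of _ w])
  then have "symp_sym_tensor v w \<in> M" for v w
    unfolding B by auto
  then have "vec.span B \<subseteq> {v. symp_tensor v v \<in> M}"
    using square by (intro vec.span_minimal subspace_symp_tensor_self[OF M]) auto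
  then have "matrix_space.span (range (\<lambda>v. symp_tensor v v)) \<subseteq> M"
    unfolding B by (intro matrix_space.span_minimal M) auto
  then show ?thesis using infinitesimal_symplectic_in_span[OF A] by blast
qed

lemma symp_sym_tensor_cong_square:
  fixes w :: "bit ^ ('g::finite + 'g)"
  assumes M: "matrix_space.subspace M"
    and square: "\<And>v. transvection 1 w ** symp_tensor v v ** transvection (- 1) w -
      symp_tensor v v \<in> M"
  shows "symp_form w x *\<^sub>M symp_tensor w w - symp_sym_tensor x w \<in> M"
proof -
  have paired_mem: "symp_tensor w w - symp_sym_tensor v w \<in> M" if "symp_form w v = 1" for v
    using square[of v] that symp_form_skew[of v w]
    unfolding transvection_conj_diff[OF is_infinitesimal_multiplier_symp_tensor]
    by (simp add: symp_tensor_mult_vec symp_form_linear uminus_bit_def)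
  consider (zero) "w = 0" | (paired) "symp_form w x = 1" | (orthogonal) "symp_form w x = 0" "w \<noteq> 0"
    by (cases "symp_form w x") auto
  then show ?thesis
  proof cases
    case zero
    then show ?thesis
      by (simp add: symp_sym_tensor_commute[of x] matrix_space.subspace_0[OF M])
  next
    case paired
    then show ?thesis using paired_mem[OF paired] by simp
  next
    case orthogonal
    then obtain j where "w $ j = 1" by (auto simp: vec_eq_iff)
    then have "symp_form w (x + symp_dual j) = 1" "symp_form w (symp_dual j) = 1"
      using orthogonal(1) by (simp_all add: symp_form_add_right)
    then have "(symp_tensor w w - symp_sym_tensor (x + symp_dual j) w) -
        (symp_tensor w w - symp_sym_tensor (symp_dual j) w) \<in> M"
      by (intro matrix_space.subspace_diff[OF M] paired_mem)
    then show ?thesis using orthogonal(1) by (simp add: symp_sym_tensor_add_left)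
  qed
qed

text \<open>The commutators with \<open>v \<otimes> v\<close> only identify \<open>x \<otimes> w + w \<otimes> x\<close> with \<open>\<langle>w, x\<rangle> w \<otimes> w\<close> modulo \<open>M\<close>; the
  projection, whose infinitesimal multiplier is \<open>1\<close>, forces \<open>w \<otimes> w\<close> itself into \<open>M\<close>.\<close>

lemma transvection_commutators_mem_subspace:
  fixes w :: "bit ^ ('g::finite + 'g)"
  assumes M: "matrix_space.subspace M"
    and square: "\<And>v. transvection 1 w ** symp_tensor v v ** transvection (- 1) w -
      symp_tensor v v \<in> M"
    and proj: "transvection 1 w ** lagrangian_proj ** transvection (- 1) w - lagrangian_proj \<in> M"
  shows "symp_tensor w w \<in> M" and "symp_sym_tensor v w \<in> M"
proof -
  define w' where "w' = lagrangian_proj *v w"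
  define pairing where "pairing = symp_form w w'"
  have "(1 - pairing) *\<^sub>M symp_tensor w w - symp_sym_tensor w' w \<in> M"
    using proj unfolding transvection_conj_diff[OF is_infinitesimal_multiplier_lagrangian_proj]
      w'_def pairing_def by simp
  moreover have "pairing *\<^sub>M symp_tensor w w - symp_sym_tensor w' w \<in> M"
    unfolding pairing_def by (rule symp_sym_tensor_cong_square[OF M square])
  ultimately have "((1 - pairing) *\<^sub>M symp_tensor w w - symp_sym_tensor w' w) -
      (pairing *\<^sub>M symp_tensor w w - symp_sym_tensor w' w) \<in> M"
    by (rule matrix_space.subspace_diff[OF M])
  moreover have "(1 - pairing) *\<^sub>M symp_tensor w w - pairing *\<^sub>M symp_tensor w w = symp_tensor w w"
    by (cases pairing) (simp_all add: vec_eq_iff uminus_bit_def)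
  ultimately show square_mem: "symp_tensor w w \<in> M" by simp
  have "symp_form w v *\<^sub>M symp_tensor w w -
      (symp_form w v *\<^sub>M symp_tensor w w - symp_sym_tensor v w) \<in> M"
    by (intro matrix_space.subspace_diff[OF M] matrix_space.subspace_scale[OF M] square_mem
        symp_sym_tensor_cong_square[OF M square])
  then show "symp_sym_tensor v w \<in> M" by simp
qed

section \<open>Transpositions act as transvections\<close>

lemma dot2_axis: "dot2 (axis i 1) v = v $ i"
  by (simp add: dot2_def axis_def if_distrib[of "\<lambda>x. x * _"] cong: if_cong)

lemma dot2_add_left: "dot2 (u + v) w = dot2 u w + dot2 v w"
  and dot2_smult_left: "dot2 (c *s v) w = c * dot2 v w"
  by (simp_all add: dot2_def algebra_simps sum.distrib sum_distrib_left)

lemma subspace_ones_perp: "vec.subspace ones_perp"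
  by (rule vec.subspaceI)
    (simp_all add: ones_perp_def dot2_add_left dot2_smult_left, simp add: dot2_def)

lemma ones_class_add_all_ones: "ones_class (v + all_ones) = ones_class v"
proof -
  have all_ones: "all_ones \<in> vec.span {all_ones}" by (simp add: vec.span_base)
  have "(+) all_ones ` vec.span {all_ones} = vec.span {all_ones}"
  proof (intro equalityI subsetI)
    fix x assume "x \<in> vec.span {all_ones}"
    then have "x - all_ones \<in> vec.span {all_ones}" using all_ones by (rule vec.span_diff)
    then show "x \<in> (+) all_ones ` vec.span {all_ones}"
      by (intro image_eqI[of _ _ "x - all_ones"]) simp_all
  qed (use vec.span_add[OF all_ones] in auto)
  then have "(\<lambda>x. v + (all_ones + x)) ` vec.span {all_ones} = (+) v ` vec.span {all_ones}"
    by (metis image_image)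
  then show ?thesis by (simp add: ones_class_def add.assoc)
qed

definition axis_pair :: "'m \<Rightarrow> 'm \<Rightarrow> bit ^ 'm::finite"
  where "axis_pair i j = axis i 1 + axis j 1"

lemma axis_pair_in_ones_perp: "axis_pair i j \<in> ones_perp"
  by (simp add: ones_perp_def axis_pair_def dot2_add_left dot2_axis all_ones_def)

lemma dot2_axis_pair: "dot2 (axis_pair i j) v = v $ i + v $ j"
  by (simp add: axis_pair_def dot2_add_left dot2_axis)

lemma permute_coords_transpose:
  "permute_coords (Transposition.transpose i j) v = v + dot2 (axis_pair i j) v *s axis_pair i j"
proof -
  have inv: "inv_into UNIV (Transposition.transpose i j) = Transposition.transpose i j"
    by (rule inv_unique_comp) (simp_all add: fun_eq_iff)
  have "v $ Transposition.transpose i j k = v $ k + (v $ i + v $ j) * axis_pair i j $ k" for k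
    by (cases "v $ i"; cases "v $ j"; cases "k = i"; cases "k = j")
      (simp_all add: axis_pair_def axis_def)
  then show ?thesis
    by (simp only: vec_eq_iff permute_coords_def inv dot2_axis_pair vec_lambda_beta
        vector_add_component vector_smult_component) simp
qed

lemma ones_perp_eq_sum_axis_pair:
  assumes "v \<in> ones_perp"
  shows "v = (\<Sum>i\<in>UNIV. v $ i *s axis_pair i k)"
proof -
  have "(\<Sum>i\<in>UNIV. v $ i) = 0"
    using assms by (simp add: ones_perp_def dot2_def all_ones_def)
  then have "(\<Sum>i\<in>UNIV. v $ i *s axis k 1) = 0"
    by (simp flip: vec.scale_sum_left)
  then show ?thesis
    by (simp add: axis_pair_def vec.scale_right_distrib sum.distrib basis_expansion)
qed

locale symp_identified =
  fixes \<iota> :: "(bit ^ 'm::finite) set \<Rightarrow> bit ^ ('g::finite + 'g)"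
  assumes identification: "symp_identification \<iota>"
begin

definition W_coords :: "bit ^ 'm \<Rightarrow> bit ^ ('g + 'g)"
  where "W_coords v = \<iota> (ones_class v)"

lemma W_coords_add:
    "v \<in> ones_perp \<Longrightarrow> w \<in> ones_perp \<Longrightarrow> W_coords (v + w) = W_coords v + W_coords w"
  and W_coords_smult: "v \<in> ones_perp \<Longrightarrow> W_coords (c *s v) = c *s W_coords v"
  and symp_form_W_coords:
    "v \<in> ones_perp \<Longrightarrow> w \<in> ones_perp \<Longrightarrow> symp_form (W_coords v) (W_coords w) = dot2 v w"
  using identification by (simp_all add: symp_identification_def W_coords_def)

lemma W_coords_sum:
  assumes "\<And>i. i \<in> I \<Longrightarrow> f i \<in> ones_perp"
  shows "W_coords (\<Sum>i\<in>I. f i) = (\<Sum>i\<in>I. W_coords (f i))"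
  using assms
proof (induction I rule: infinite_finite_induct)
  case (insert i I)
  then show ?case
    by (simp add: W_coords_add vec.subspace_sum[OF subspace_ones_perp])
qed (use W_coords_smult[OF vec.subspace_0[OF subspace_ones_perp], of 0] in simp_all)

lemma transvection_in_sym_stabilizer:
  assumes "i \<noteq> l" "j \<noteq> l"
  shows "transvection 1 (W_coords (axis_pair i j)) \<in> sym_stabilizer \<iota> l"
proof -
  have "acts_as_perm \<iota> (transvection 1 (W_coords (axis_pair i j))) (Transposition.transpose i j)"
    unfolding acts_as_perm_def W_coords_def[symmetric] permute_coords_transpose
    by (simp add: transvection_mult_vec symp_form_W_coords axis_pair_in_ones_perp W_coords_add
        W_coords_smult vec.subspace_scale[OF subspace_ones_perp])
  moreover have "Transposition.transpose i j permutes UNIV"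
    by (rule permutes_swap_id) auto
  ultimately show ?thesis
    using assms unfolding sym_stabilizer_def
    by (auto simp: Transposition.transpose_def intro!: exI[of _ "Transposition.transpose i j"])
qed

lemma W_coords_surj:
  assumes "even CARD('m)"
  obtains v where "v \<in> ones_perp" "v $ l = 0" "W_coords v = u"
proof -
  have "u \<in> \<iota> ` W_space"
    using identification by (simp add: symp_identification_def bij_betw_def)
  then obtain v where v: "v \<in> ones_perp" "W_coords v = u"
    by (auto simp: W_space_def W_coords_def)
  show thesis
  proof (cases "v $ l")
    case zero
    then show thesis using v that by blast
  next
    case one
    have "of_nat CARD('m) = (0 :: bit)" using assms by (auto elim!: evenE)
    then have "all_ones \<in> (ones_perp :: (bit ^ 'm) set)"
      by (simp add: ones_perp_def dot2_def all_ones_def)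
    then have "v + all_ones \<in> ones_perp" by (rule vec.subspace_add[OF subspace_ones_perp v(1)])
    moreover have "(v + all_ones) $ l = 0" using one by (simp add: all_ones_def)
    moreover have "W_coords (v + all_ones) = u"
      using v by (simp add: W_coords_def ones_class_add_all_ones)
    ultimately show thesis by (rule that)
  qed
qed

lemma span_W_coords_axis_pair:
  assumes "even CARD('m)"
  shows "vec.span {W_coords (axis_pair i j) | i j. i \<noteq> l \<and> j \<noteq> l} = UNIV" (is "vec.span ?B = _")
proof -
  have "\<exists>k. k \<noteq> l"
  proof (rule ccontr)
    assume "\<nexists>k. k \<noteq> l"
    then have "UNIV = {l}" by auto
    then have "CARD('m) = card {l}" by simp
    then show False using assms by simp
  qed
  then obtain k where k: "k \<noteq> l" by blast
  have "u \<in> vec.span ?B" for u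
  proof -
    obtain v where v: "v \<in> ones_perp" "v $ l = 0" "W_coords v = u"
      using assms by (rule W_coords_surj)
    have "u = W_coords (\<Sum>i\<in>UNIV. v $ i *s axis_pair i k)"
      using ones_perp_eq_sum_axis_pair[OF v(1)] v(3) by simp
    also have "\<dots> = (\<Sum>i\<in>UNIV. v $ i *s W_coords (axis_pair i k))"
      by (simp add: W_coords_sum W_coords_smult vec.subspace_scale[OF subspace_ones_perp]
          axis_pair_in_ones_perp)
    also have "\<dots> \<in> vec.span ?B"
    proof (rule vec.span_sum)
      fix i
      show "v $ i *s W_coords (axis_pair i k) \<in> vec.span ?B"
        using v(2) k by (cases "i = l") (auto intro: vec.span_zero vec.span_scale vec.span_base)
    qed
    finally show ?thesis .
  qed
  then show ?thesis by blast
qed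

end

section \<open>The multiplier homomorphism\<close>

lemma z2_units_simps [simp]:
  "u \<in> carrier z2_units \<longleftrightarrow> u dvd 1" "u \<otimes>\<^bsub>z2_units\<^esub> v = u * v" "\<one>\<^bsub>z2_units\<^esub> = 1"
  by (simp_all add: z2_units_def)

lemma comm_group_z2_units: "comm_group z2_units"
proof (rule comm_groupI)
  fix u v assume "u \<in> carrier z2_units" "v \<in> carrier z2_units"
  then show "u \<otimes>\<^bsub>z2_units\<^esub> v \<in> carrier z2_units" using mult_dvd_mono[of u 1 v 1] by simp
next
  fix u assume "u \<in> carrier z2_units"
  then obtain v where "1 = u * v" by (auto elim: dvdE)
  then show "\<exists>v\<in>carrier z2_units. v \<otimes>\<^bsub>z2_units\<^esub> u = \<one>\<^bsub>z2_units\<^esub>"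
    by (intro bexI[of _ v]) (simp_all add: mult.commute dvdI[of 1 v u])
qed (simp_all add: mult_ac)

interpretation multiplier: group_hom GSp z2_units
    "multiplier :: z2adic ^ ('g::finite + 'g) ^ ('g + 'g) \<Rightarrow> z2adic"
  by (auto simp: group_hom_def group_hom_axioms_def group_GSp comm_group_z2_units
      comm_group.axioms(2) hom_def multiplier_mult multiplier_unit)

lemma kernel_multiplier: "kernel GSp z2_units multiplier = carrier Sp"
  by (auto simp: kernel_def carrier_Sp_iff)

lemma subgroup_Sp: "subgroup (carrier Sp) (GSp :: (z2adic ^ ('g::finite + 'g) ^ ('g + 'g)) monoid)"
  using multiplier.subgroup_kernel by (simp add: kernel_multiplier)

lemma (in group_hom) derived_subset_kernel:
  assumes "comm_group H" "K \<subseteq> carrier G"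
  shows "derived G K \<subseteq> kernel G H h"
proof -
  have "h ` derived G K = derived H (h ` K)"
    using derived_img[OF assms(2)] by simp
  also have "\<dots> = {\<one>\<^bsub>H\<^esub>}"
    using assms(2) by (intro comm_group.derived_eq_singleton[OF assms(1)]) auto
  finally show ?thesis
    using G.derived_in_carrier[OF assms(2)] by (auto simp: kernel_def)
qed

section \<open>The closure of the derived subgroup\<close>

interpretation red2_mat: group_hom GSp GSp
    "red2_mat :: z2adic ^ ('g::finite + 'g) ^ ('g + 'g) \<Rightarrow> _"
  by (rule red2.map_matrix_group_hom)

lemma mat_cong_2_iff: "mat_cong 2 X Y \<longleftrightarrow> red2_mat X = red2_mat Y"
proof -
  have "mat_cong 2 X Y \<longleftrightarrow> (\<forall>i j. red2 (X $ i $ j - Y $ i $ j) = 0)"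
    by (simp only: mat_cong_def red2_eq_0_iff)
  then show ?thesis by (simp add: vec_eq_iff)
qed

locale full_preimage =
  fixes H :: "(z2adic ^ ('g::finite + 'g) ^ ('g + 'g)) set"
  assumes subgroup_H: "subgroup H GSp"
    and full: "S \<in> carrier GSp \<Longrightarrow> red2_mat S \<in> red2_mat ` H \<Longrightarrow> S \<in> H"
begin

lemma H_subset: "H \<subseteq> carrier GSp"
  by (rule subgroup.subset[OF subgroup_H])

lemma subgroup_derived: "subgroup (derived GSp H) GSp"
  by (rule GSp.derived_is_subgroup[OF H_subset])

lemma derived_subset_H: "derived GSp H \<subseteq> H"
  by (rule GSp.derived_incl[OF subset_refl subgroup_H])

lemma derived_subset_Sp: "derived GSp H \<subseteq> carrier Sp"
  using multiplier.derived_subset_kernel[OF comm_group_z2_units H_subset]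
  by (simp only: kernel_multiplier)

lemma one_in_derived: "mat 1 \<in> derived GSp H"
  using subgroup.one_closed[OF subgroup_derived] by simp

lemma mult_in_derived: "x \<in> derived GSp H \<Longrightarrow> y \<in> derived GSp H \<Longrightarrow> x ** y \<in> derived GSp H"
  using subgroup.m_closed[OF subgroup_derived] by simp

lemma red2_mat_kernel_in_H:
  assumes "S \<in> carrier GSp" "red2_mat S = mat 1"
  shows "S \<in> H"
proof (rule full[OF assms(1)])
  have "mat 1 \<in> H" using subgroup.one_closed[OF subgroup_H] by simp
  then show "red2_mat S \<in> red2_mat ` H"
    unfolding assms(2) by (metis imageI red2.map_matrix_one)
qed

definition graded_derived :: "nat \<Rightarrow> (bit ^ ('g + 'g) ^ ('g + 'g)) set"
  where "graded_derived n = {A. \<exists>z\<in>derived GSp H. red2.graded_class (2 ^ n) z A}"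

lemma subspace_graded_derived:
  assumes "n \<ge> 1"
  shows "matrix_space.subspace (graded_derived n)"
proof (rule matrix_space.subspaceI)
  show zero: "0 \<in> graded_derived n"
    using one_in_derived red2.graded_class_one by (auto simp: graded_derived_def)
  show "A + B \<in> graded_derived n" if "A \<in> graded_derived n" "B \<in> graded_derived n" for A B
    using that red2.graded_class_mult[OF _ _ red2_two_power[OF assms]] mult_in_derived
    unfolding graded_derived_def by blast
  show "c *\<^sub>M A \<in> graded_derived n" if "A \<in> graded_derived n" for c A
    using that zero by (cases c) simp_all
qed

lemma commutator_in_graded_derived:
  assumes h: "h \<in> H" and k: "k \<in> carrier GSp" "red2.graded_class (2 ^ n) k A" and n: "n \<ge> 1"
  shows "red2_mat h ** A ** inv\<^bsub>GSp\<^esub> (red2_mat h) - A \<in> graded_derived n"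
proof -
  note two_power = red2_two_power[OF n]
  let ?h' = "inv\<^bsub>GSp\<^esub> h" and ?k' = "inv\<^bsub>GSp\<^esub> k"
  have hG: "h \<in> carrier GSp" using h H_subset by blast
  have "k \<in> H"
    using k(1) red2.graded_class_map_matrix[OF k(2) two_power] by (rule red2_mat_kernel_in_H)
  then have "h ** k ** ?h' ** ?k' \<in> derived_set GSp H" using h by auto
  then have "h ** k ** ?h' ** ?k' \<in> derived GSp H"
    unfolding derived_def by (rule generate.incl)
  moreover have "red2.graded_class (2 ^ n) (h ** k ** ?h') (red2_mat h ** A ** red2_mat ?h')"
    using k(2) GSp.r_inv[OF hG] by (rule red2.graded_class_conj)
  then have "red2.graded_class (2 ^ n) (h ** k ** ?h' ** ?k')
      (red2_mat h ** A ** red2_mat ?h' + - A)"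
    using red2.graded_class_inverse[OF k(2) GSp.r_inv[OF k(1)] two_power] two_power
    by (rule red2.graded_class_mult)
  ultimately show ?thesis
    using red2_mat.hom_inv[OF hG] by (auto simp: graded_derived_def)
qed

lemma red2_mat_derived: "red2_mat ` derived GSp H = derived GSp (red2_mat ` H)"
  by (rule red2_mat.derived_img[OF H_subset, symmetric])

lemma derived_preimage_in_H:
  assumes "S \<in> carrier Sp" "red2_mat S \<in> derived GSp (red2_mat ` H)"
  shows "S \<in> H"
  using assms derived_subset_H
  by (intro full) (auto simp: carrier_Sp_iff simp flip: red2_mat_derived)

lemma closure_of_derived_subset:
  "top_of_set H closure_of derived GSp H \<subseteq>
    {S \<in> carrier Sp. red2_mat S \<in> derived GSp (red2_mat ` H)}"
proof
  fix S assume "S \<in> top_of_set H closure_of derived GSp H"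
  then have S: "S \<in> H" and approx: "\<And>n. \<exists>Y\<in>derived GSp H. mat_cong (2 ^ n) Y S"
    by (simp_all add: mat_cong.in_closure_of_iff[OF derived_subset_H])
  have "2 ^ n dvd 1 - multiplier S" for n
  proof -
    obtain Y where Y: "Y \<in> carrier Sp" "mat_cong (2 ^ n) Y S"
      using approx[of n] derived_subset_Sp by blast
    then show ?thesis
      using multiplier_cong[of Y S "2 ^ n"] S H_subset by (auto simp: carrier_Sp_iff)
  qed
  then have "1 = multiplier S" by (rule z2adic_eqI)
  moreover obtain Y where "Y \<in> derived GSp H" "mat_cong (2 ^ 1) Y S" using approx by blast
  then have "red2_mat S \<in> red2_mat ` derived GSp H" by (simp add: mat_cong_2_iff image_iff) metis
  ultimately show "S \<in> {S \<in> carrier Sp. red2_mat S \<in> derived GSp (red2_mat ` H)}"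
    using S H_subset by (auto simp: carrier_Sp_iff red2_mat_derived)
qed

end

locale full_preimage_transvections = full_preimage H
  for H :: "(z2adic ^ ('g::finite + 'g) ^ ('g + 'g)) set" +
  assumes span_transvections: "vec.span {w. transvection 1 w \<in> red2_mat ` H} = UNIV"
begin

lemma infinitesimal_symplectic_in_graded_derived:
  assumes n: "n \<ge> 1" and A: "is_infinitesimal_multiplier A 0"
  shows "A \<in> graded_derived n"
proof (rule infinitesimal_symplectic_mem_subspace[OF _ span_transvections _ _ A])
  show subspace: "matrix_space.subspace (graded_derived n)"
    using n by (rule subspace_graded_derived)
  fix w :: "bit ^ ('g + 'g)" assume "w \<in> {w. transvection 1 w \<in> red2_mat ` H}"
  then obtain h where h: "h \<in> H" "red2_mat h = transvection 1 w" by auto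
  have commutator: "transvection 1 w ** B ** transvection (- 1) w - B \<in> graded_derived n"
    if "k \<in> carrier GSp" "red2.graded_class (2 ^ n) k B" for k B
    using commutator_in_graded_derived[OF h(1) that n] h(2) by (simp only: inv_transvection)
  have square: "transvection 1 w ** symp_tensor v v ** transvection (- 1) w - symp_tensor v v
      \<in> graded_derived n" for v
  proof -
    obtain x where "v = map_vector red2 x" using red2.surj_map_vector by (metis surjD)
    then show ?thesis
      using commutator[OF transvection_in_GSp red2.graded_class_transvection] by simp
  qed
  have proj: "transvection 1 w ** lagrangian_proj ** transvection (- 1) w - lagrangian_proj
      \<in> graded_derived n"
  proof (rule commutator[OF diag_similitude_in_GSp red2.graded_class_diag_similitude])
    have "red2 (1 + 2 ^ n) = 1" by (simp only: red2.hom_add red2_two_power[OF n]) simp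
    then show "1 + 2 ^ n dvd (1 :: z2adic)" by (simp only: z2adic_unit_iff)
  qed
  show "symp_tensor w w \<in> graded_derived n" "symp_sym_tensor v w \<in> graded_derived n" for v
    using transvection_commutators_mem_subspace[OF subspace square proj] by blast+
qed

lemma derived_approx_Suc:
  assumes x: "x \<in> carrier Sp" "mat_cong (2 ^ n) x (mat 1)" and n: "n \<ge> 1"
  shows "\<exists>z\<in>derived GSp H. mat_cong (2 ^ Suc n) z x"
proof -
  note two_power = red2_two_power[OF n]
  have xG: "x \<in> carrier GSp" "is_multiplier x (1 + 2 ^ n * 0)"
    using x(1) is_multiplier_multiplier[of x] by (simp_all add: carrier_Sp_iff)
  obtain A where A: "red2.graded_class (2 ^ n) x A"
    using x(2) by (auto simp: red2.mat_cong_one_iff)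
  have "is_infinitesimal_multiplier A (red2 0)"
    using A xG(2) two_power
    by (rule red2.graded_class_infinitesimal_multiplier) (simp add: two_power_mult_left_cancel)
  then obtain z where z: "z \<in> derived GSp H" "red2.graded_class (2 ^ n) z A"
    using infinitesimal_symplectic_in_graded_derived[OF n, of A] by (auto simp: graded_derived_def)
  have zG: "z \<in> carrier GSp" using z(1) derived_subset_H H_subset by blast
  have "red2.graded_class (2 ^ n) (inv\<^bsub>GSp\<^esub> z ** x) (- A + A)"
    using red2.graded_class_inverse[OF z(2) GSp.r_inv[OF zG] two_power] A two_power
    by (rule red2.graded_class_mult)
  then have "mat_cong (2 ^ n * 2) (inv\<^bsub>GSp\<^esub> z ** x) (mat 1)"
    by (intro red2.graded_class_zero) (simp_all add: red2_eq_0_iff)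
  then have "mat_cong (2 ^ n * 2) (z ** mat 1) (z ** (inv\<^bsub>GSp\<^esub> z ** x))"
    by (intro mat_cong_mult) (simp_all add: mat_cong_sym)
  then have "mat_cong (2 ^ Suc n) z x"
    using GSp.r_inv[OF zG] by (simp add: matrix_mul_assoc mult.commute)
  then show ?thesis using z(1) by blast
qed

lemma derived_approx:
  assumes S: "S \<in> carrier Sp" "red2_mat S \<in> derived GSp (red2_mat ` H)"
  shows "\<exists>y\<in>derived GSp H. mat_cong (2 ^ Suc n) y S"
proof (induction n)
  case 0
  have "red2_mat S \<in> red2_mat ` derived GSp H" using S(2) by (simp only: red2_mat_derived)
  then show ?case by (auto simp: mat_cong_2_iff)
next
  case (Suc n)
  then obtain y where y: "y \<in> derived GSp H" "mat_cong (2 ^ Suc n) y S" by blast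
  have ySp: "y \<in> carrier Sp" using y(1) derived_subset_Sp by blast
  then have yG: "y \<in> carrier GSp" by (simp add: carrier_Sp_iff)
  define x where "x = inv\<^bsub>GSp\<^esub> y ** S"
  have yx: "y ** x = S" using GSp.r_inv[OF yG] by (simp add: x_def matrix_mul_assoc)
  have "x \<in> carrier Sp"
    using subgroup.m_closed[OF subgroup_Sp subgroup.m_inv_closed[OF subgroup_Sp ySp] S(1)]
    by (simp add: x_def)
  moreover have "mat_cong (2 ^ Suc n) (inv\<^bsub>GSp\<^esub> y ** y) x"
    unfolding x_def using y(2) by (intro mat_cong_mult) simp_all
  then have "mat_cong (2 ^ Suc n) x (mat 1)"
    using GSp.l_inv[OF yG] by (simp add: mat_cong_sym)
  ultimately obtain z where z: "z \<in> derived GSp H" "mat_cong (2 ^ Suc (Suc n)) z x"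
    using derived_approx_Suc[of x "Suc n"] by auto
  then have "mat_cong (2 ^ Suc (Suc n)) (y ** z) (y ** x)" by (intro mat_cong_mult) simp_all
  then show ?case using mult_in_derived[OF y(1) z(1)] yx by auto
qed

lemma closure_of_derived:
  "top_of_set H closure_of derived GSp H =
    {S \<in> carrier Sp. red2_mat S \<in> derived GSp (red2_mat ` H)}"
proof (intro equalityI closure_of_derived_subset subsetI)
  fix S assume S: "S \<in> {S \<in> carrier Sp. red2_mat S \<in> derived GSp (red2_mat ` H)}"
  then have "\<exists>y\<in>derived GSp H. mat_cong (2 ^ n) y S" for n
    using derived_approx[of S n] mat_cong.mono[of "Suc n" _ S n] by auto
  moreover have "S \<in> H" using S derived_preimage_in_H by blast
  ultimately show "S \<in> top_of_set H closure_of derived GSp H"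
    by (simp add: mat_cong.in_closure_of_iff[OF derived_subset_H])
qed

end

section \<open>The topological abelianization\<close>

lemma quotient_map_quot_topology: "quotient_map X (quot_topology X q) q"
proof -
  have "openin (quot_topology X q) (q ` topspace X)"
    by (auto simp: openin_quot_topology intro: openin_subopen[THEN iffD2])
  then have "topspace (quot_topology X q) = q ` topspace X"
    by (metis openin_quot_topology openin_subset openin_topspace subset_antisym)
  then show ?thesis by (simp add: quotient_map_def openin_quot_topology)
qed

lemma top_derived_discrete:
  assumes "group G"
  shows "top_derived (discrete_topology (carrier G)) G = derived G (carrier G)"
  using group.derived_in_carrier[OF assms subset_refl]
  by (simp add: top_derived_def closure_of_eq)

lemma ab_topology_discrete:
  "ab_topology (discrete_topology S) G =
    discrete_topology (ab_class (discrete_topology S) G ` S)"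
  by (auto simp: topology_eq ab_topology_def openin_quot_topology)

lemma ab_class_hom:
  "top_derived X G \<lhd> G \<Longrightarrow> ab_class X G \<in> hom G (top_ab X G)"
  using normal.r_coset_hom_Mod[of "top_derived X G" G]
  by (simp add: ab_class_def[abs_def] top_ab_def)

lemma carrier_top_ab: "carrier (top_ab X G) = ab_class X G ` carrier G"
  by (simp add: top_ab_def carrier_FactGroup ab_class_def)

lemma ab_class_eq_one_iff:
  assumes "top_derived X G \<lhd> G" "x \<in> carrier G"
  shows "ab_class X G x = \<one>\<^bsub>top_ab X G\<^esub> \<longleftrightarrow> x \<in> top_derived X G"
proof -
  interpret normal "top_derived X G" G by fact
  show ?thesis
    unfolding ab_class_def top_ab_def one_FactGroup
    using assms(2) coset_join1 coset_join2 subgroup_axioms subset by blast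
qed

lemma (in group_hom) image_kernel_coset:
  assumes "x \<in> carrier G"
  shows "h ` (kernel G H h #> x) = {h x}"
proof -
  have "h (k \<otimes> x) = h x" if "k \<in> kernel G H h" for k
    using that assms by (simp add: kernel_def)
  moreover have "\<one> \<in> kernel G H h" by (rule subgroup.one_closed[OF subgroup_kernel])
  ultimately show ?thesis by (auto simp: r_coset_def image_iff)
qed

lemma (in group_hom) top_ab_homeomorphic_iso:
  assumes ker: "kernel G H h = top_derived X G" and surj: "h ` carrier G = carrier H"
    and X: "topspace X = carrier G" and Y: "topspace Y = carrier H"
    and cont: "continuous_map X Y h" and opn: "open_map X Y h"
  shows "\<exists>\<Psi>. \<Psi> \<in> iso (top_ab X G) H \<and> homeomorphic_map (ab_topology X G) Y \<Psi> \<and>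
    (\<forall>x\<in>carrier G. \<Psi> (ab_class X G x) = h x)"
proof (intro exI conjI ballI)
  define \<Psi> where "\<Psi> C = the_elem (h ` C)" for C
  show iso: "\<Psi> \<in> iso (top_ab X G) H"
    unfolding \<Psi>_def top_ab_def ker[symmetric] using surj by (rule FactGroup_iso_set)
  show factor: "\<Psi> (ab_class X G x) = h x" if "x \<in> carrier G" for x
    using image_kernel_coset[OF that] by (simp add: \<Psi>_def ab_class_def flip: ker)
  have quotient: "quotient_map X (ab_topology X G) (ab_class X G)"
    unfolding ab_topology_def by (rule quotient_map_quot_topology)
  have "quotient_map X Y h"
    using cont opn surj X Y by (intro continuous_open_imp_quotient_map) simp_all
  then have "quotient_map X Y (\<Psi> \<circ> ab_class X G)"
    by (rule quotient_map_eq) (simp add: X factor)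
  then have "quotient_map (ab_topology X G) Y \<Psi>"
    by (simp only: quotient_map_compose_eq[OF quotient])
  moreover have "topspace (ab_topology X G) = carrier (top_ab X G)"
    using quotient_imp_surjective_map[OF quotient] by (simp add: X carrier_top_ab)
  then have "inj_on \<Psi> (topspace (ab_topology X G))"
    using iso by (simp add: iso_def bij_betw_def)
  ultimately show "homeomorphic_map (ab_topology X G) Y \<Psi>"
    by (simp add: homeomorphic_map_def)
qed

section \<open>The reduced abelianization and the multiplier\<close>

interpretation z2adic: congruence_topology "\<lambda>n x y :: z2adic. 2 ^ n dvd x - y"
  by (rule congruence_topology_z2adic)

context full_preimage
begin

abbreviation "G \<equiv> GSp\<lparr>carrier := H\<rparr>"
abbreviation "G2 \<equiv> GSp\<lparr>carrier := red2_mat ` H\<rparr>"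
abbreviation "T \<equiv> top_of_set H"
abbreviation "T2 \<equiv> discrete_topology (red2_mat ` H)"

lemma group_G: "group G"
  by (rule GSp.subgroup_imp_group[OF subgroup_H])

lemma subgroup_red2_H: "subgroup (red2_mat ` H) GSp"
  by (rule red2_mat.subgroup_img_is_subgroup[OF subgroup_H])

lemma top_derived_T2: "top_derived T2 G2 = derived G2 (carrier G2)"
  using top_derived_discrete[OF GSp.subgroup_imp_group[OF subgroup_red2_H]] by simp

lemma top_derived_T2_eq: "top_derived T2 G2 = derived GSp (red2_mat ` H)"
  using GSp.derived_consistent[OF subset_refl subgroup_red2_H] by (simp add: top_derived_T2)

lemma normal_top_derived_T2: "top_derived T2 G2 \<lhd> G2"
  unfolding top_derived_T2
  by (rule group.derived_self_is_normal[OF GSp.subgroup_imp_group[OF subgroup_red2_H]])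

lemma multiplier_unit_H: "S \<in> H \<Longrightarrow> multiplier S dvd 1"
  using multiplier_unit H_subset by blast

definition ab_multiplier ::
    "z2adic ^ ('g + 'g) ^ ('g + 'g) \<Rightarrow> (bit ^ ('g + 'g) ^ ('g + 'g)) set \<times> z2adic"
  where "ab_multiplier S = (ab_class T2 G2 (red2_mat S), multiplier S)"

lemma ab_multiplier_group_hom: "group_hom G (top_ab T2 G2 \<times>\<times> z2_units) ab_multiplier"
proof -
  have "red2_mat \<in> hom G G2"
    using H_subset by (auto simp: hom_def)
  then have "ab_class T2 G2 \<circ> red2_mat \<in> hom G (top_ab T2 G2)"
    using ab_class_hom[OF normal_top_derived_T2] by (rule hom_compose)
  moreover have "multiplier \<in> hom G z2_units"
    using H_subset by (auto simp: hom_def multiplier_mult multiplier_unit_H subset_iff)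
  ultimately have "ab_multiplier \<in> hom G (top_ab T2 G2 \<times>\<times> z2_units)"
    unfolding ab_multiplier_def by (simp add: hom_paired comp_def)
  moreover have "group (top_ab T2 G2 \<times>\<times> z2_units)"
    unfolding top_ab_def
    by (intro DirProd_group normal.factorgroup_is_group normal_top_derived_T2
        comm_group.axioms(2) comm_group_z2_units)
  ultimately show ?thesis
    using group_G by (simp add: group_hom_def group_hom_axioms_def)
qed

lemma kernel_ab_multiplier:
  "kernel G (top_ab T2 G2 \<times>\<times> z2_units) ab_multiplier =
    {S \<in> carrier Sp. red2_mat S \<in> derived GSp (red2_mat ` H)}"
proof -
  have "ab_class T2 G2 (red2_mat S) = \<one>\<^bsub>top_ab T2 G2\<^esub> \<longleftrightarrow> red2_mat S \<in> derived GSp (red2_mat ` H)"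
    if "S \<in> H" for S
    using ab_class_eq_one_iff[OF normal_top_derived_T2, of "red2_mat S"] that
    by (simp add: top_derived_T2_eq)
  then show ?thesis
    using H_subset derived_preimage_in_H
    by (auto simp: kernel_def ab_multiplier_def carrier_Sp_iff)
qed

lemma multiplier_adjustment:
  assumes X: "X \<in> H" and u: "u dvd 1" "2 ^ n dvd u - multiplier X" and n: "n \<ge> 1"
  obtains Y where "Y \<in> H" "mat_cong (2 ^ n) Y X" "multiplier Y = u"
proof -
  have XG: "X \<in> carrier GSp" using X H_subset by blast
  obtain c where c: "multiplier X * c = 1" using multiplier_unit[OF XG] by (metis dvdE)
  define t where "t = c * u"
  have "c dvd 1" using c by (metis dvd_triv_right)
  then have t: "t dvd 1" using mult_dvd_mono[of c 1 u 1] u(1) by (simp add: t_def)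
  have "t - 1 = c * (u - multiplier X)"
    using c by (simp add: t_def right_diff_distrib mult.commute)
  then have "mat_cong (2 ^ n) (diag_similitude t) (mat 1)"
    using u(2) by (simp add: mat_cong_def diag_similitude_def)
  then have "mat_cong (2 ^ n) (X ** diag_similitude t) (X ** mat 1)"
    by (intro mat_cong_mult) simp_all
  then have cong: "mat_cong (2 ^ n) (X ** diag_similitude t) X" by simp
  have "mat_cong (2 ^ 1) (X ** diag_similitude t) X" using cong n by (rule mat_cong.mono)
  then have "red2_mat (X ** diag_similitude t) = red2_mat X"
    by (simp only: power_one_right mat_cong_2_iff)
  then have "X ** diag_similitude t \<in> H"
    using GSp.m_closed[OF XG diag_similitude_in_GSp[OF t]] X by (intro full) (simp_all only: imageI)
  moreover have "multiplier (X ** diag_similitude t) = multiplier X * t"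
    by (simp add: multiplier_mult XG diag_similitude_in_GSp t
        multiplier_eqI[OF is_multiplier_diag_similitude])
  then have "multiplier (X ** diag_similitude t) = u"
    using c by (simp add: t_def flip: mult.assoc)
  ultimately show thesis using cong that by blast
qed

lemma image_ab_multiplier:
  "ab_multiplier ` H = ab_class T2 G2 ` red2_mat ` H \<times> carrier z2_units"
proof (intro equalityI subsetI)
  fix p assume "p \<in> ab_class T2 G2 ` red2_mat ` H \<times> carrier z2_units"
  then obtain X u where X: "X \<in> H" "u dvd 1" "p = (ab_class T2 G2 (red2_mat X), u)" by auto
  then have "red2 (u - multiplier X) = 0"
    using multiplier_unit_H[of X] by (simp add: z2adic_unit_iff)
  then have "2 ^ 1 dvd u - multiplier X" by (simp only: red2_eq_0_iff power_one_right)
  then obtain Y where "Y \<in> H" "mat_cong (2 ^ 1) Y X" "multiplier Y = u"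
    by (rule multiplier_adjustment[OF X(1,2)]) simp
  then show "p \<in> ab_multiplier ` H"
    by (auto simp: X(3) ab_multiplier_def mat_cong_2_iff image_iff intro!: bexI[of _ Y])
qed (auto simp: ab_multiplier_def multiplier_unit_H)

lemma continuous_map_ab_multiplier:
  "continuous_map T (prod_topology (ab_topology T2 G2) z2_units_topology) ab_multiplier"
  unfolding continuous_map_pairwise
proof
  have "continuous_map T (ab_topology T2 G2) (\<lambda>S. ab_class T2 G2 (red2_mat S))"
    unfolding ab_topology_discrete
  proof (rule mat_cong.continuous_map_discreteI)
    fix X
    have "\<forall>Y\<in>H. mat_cong (2 ^ 1) Y X \<longrightarrow> ab_class T2 G2 (red2_mat Y) = ab_class T2 G2 (red2_mat X)"
      by (simp add: mat_cong_2_iff)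
    then show "\<exists>n. \<forall>Y\<in>H. mat_cong (2 ^ n) Y X \<longrightarrow>
        ab_class T2 G2 (red2_mat Y) = ab_class T2 G2 (red2_mat X)" ..
  qed auto
  then show "continuous_map T (ab_topology T2 G2) (fst \<circ> ab_multiplier)"
    by (simp add: ab_multiplier_def comp_def)
  have "continuous_map T z2_units_topology multiplier"
  proof (rule continuous_map_congruence_topologyI)
    show "congruence_topology (\<lambda>n. mat_cong (2 ^ n :: z2adic))"
      by (rule mat_cong.congruence_topology_axioms)
    show "congruence_topology (\<lambda>n x y :: z2adic. 2 ^ n dvd x - y)"
      by (rule congruence_topology_z2adic)
    show "multiplier ` H \<subseteq> carrier z2_units"
      using multiplier_unit_H by auto
    fix X n assume "X \<in> H"
    then show "\<exists>m. \<forall>Y\<in>H. mat_cong (2 ^ m) Y X \<longrightarrow> 2 ^ n dvd multiplier Y - multiplier X"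
      using multiplier_cong H_subset by blast
  qed
  then show "continuous_map T z2_units_topology (snd \<circ> ab_multiplier)"
    by (simp add: ab_multiplier_def comp_def)
qed

lemma open_map_ab_multiplier:
  "open_map T (prod_topology (ab_topology T2 G2) z2_units_topology) ab_multiplier"
  unfolding open_map_def openin_prod_topology_alt
proof (intro allI impI)
  fix V C u assume V: "openin T V" and "(C, u) \<in> ab_multiplier ` V"
  then obtain X where X: "X \<in> V" "C = ab_class T2 G2 (red2_mat X)" "u = multiplier X"
    by (auto simp: ab_multiplier_def)
  have XH: "X \<in> H" using V X(1) openin_subset by fastforce
  obtain n where n: "\<And>Y. Y \<in> H \<Longrightarrow> mat_cong (2 ^ n) Y X \<Longrightarrow> Y \<in> V"
    using V X(1) unfolding mat_cong.openin_iff by blast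
  define W where "W = carrier z2_units \<inter> {w. 2 ^ Suc n dvd w - u}"
  have "{C} \<times> W \<subseteq> ab_multiplier ` V"
  proof clarify
    fix w assume "w \<in> W"
    then obtain Y where Y: "Y \<in> H" "mat_cong (2 ^ Suc n) Y X" "multiplier Y = w"
      using multiplier_adjustment[OF XH, of w "Suc n"] by (auto simp: W_def X(3))
    have "mat_cong (2 ^ n) Y X" "mat_cong (2 ^ 1) Y X" using Y(2) by (rule mat_cong.mono, simp)+
    then have "Y \<in> V" "red2_mat Y = red2_mat X" using n Y(1) by (simp_all add: mat_cong_2_iff)
    then show "(C, w) \<in> ab_multiplier ` V"
      by (intro image_eqI[of _ _ Y]) (simp_all add: ab_multiplier_def X(2) Y(3))
  qed
  moreover have "openin z2_units_topology W"
    unfolding W_def by (intro openin_open_Int z2adic.open_class)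
  moreover have "openin (ab_topology T2 G2) {C}"
    using XH X(2) by (auto simp: ab_topology_discrete)
  moreover have "u \<in> W"
    using multiplier_unit_H[OF XH] X(3) by (simp add: W_def)
  ultimately show "\<exists>A B. openin (ab_topology T2 G2) A \<and> openin z2_units_topology B \<and>
      C \<in> A \<and> u \<in> B \<and> A \<times> B \<subseteq> ab_multiplier ` V"
    by blast
qed

end

context full_preimage_transvections
begin

lemma top_derived_eq: "top_derived T G = {S \<in> carrier Sp. red2_mat S \<in> top_derived T2 G2}"
  using closure_of_derived GSp.derived_consistent[OF subset_refl subgroup_H]
  by (simp add: top_derived_T2_eq) (simp add: top_derived_def)

lemma top_ab_iso:
  "\<exists>\<Psi>. \<Psi> \<in> iso (top_ab T G) (top_ab T2 G2 \<times>\<times> z2_units) \<and>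
    homeomorphic_map (ab_topology T G) (prod_topology (ab_topology T2 G2) z2_units_topology) \<Psi> \<and>
    (\<forall>S\<in>H. \<Psi> (ab_class T G S) = ab_multiplier S)"
  using group_hom.top_ab_homeomorphic_iso[OF ab_multiplier_group_hom, of T
      "prod_topology (ab_topology T2 G2) z2_units_topology"]
    continuous_map_ab_multiplier open_map_ab_multiplier
  by (simp add: kernel_ab_multiplier top_derived_eq top_derived_T2_eq image_ab_multiplier
      carrier_top_ab ab_topology_discrete)

end

lemma full_preimage_transvections_if_sym_stabilizer:
  fixes H :: "(z2adic ^ ('g::finite + 'g) ^ ('g + 'g)) set"
    and \<iota> :: "(bit ^ 'm::finite) set \<Rightarrow> bit ^ ('g + 'g)"
  assumes "even CARD('m)" "symp_identification \<iota>" "sym_stabilizer \<iota> l \<subseteq> red2_mat ` H"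
    and "subgroup H GSp" and H: "H = {S \<in> carrier GSp. red2_mat S \<in> red2_mat ` H}"
  shows "full_preimage_transvections H"
proof (intro full_preimage_transvections.intro full_preimage.intro
    full_preimage_transvections_axioms.intro)
  interpret symp_identified \<iota> by unfold_locales fact
  have "{W_coords (axis_pair i j) | i j. i \<noteq> l \<and> j \<noteq> l} \<subseteq> {w. transvection 1 w \<in> red2_mat ` H}"
    using transvection_in_sym_stabilizer assms(3) by blast
  then show "vec.span {w. transvection 1 w \<in> red2_mat ` H} = UNIV"
    using vec.span_mono span_W_coords_axis_pair[OF assms(1)] by blast
  show "S \<in> H" if "S \<in> carrier GSp" "red2_mat S \<in> red2_mat ` H" for S
    using that H by blast
qed fact

theorem theorem2p2:
  fixes H :: "(z2adic ^ ('g::finite + 'g) ^ ('g + 'g)) set"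
    and \<iota> :: "(bit ^ 'm::finite) set \<Rightarrow> bit ^ ('g + 'g)"
    and l :: 'm
  defines "H2 \<equiv> red2_mat ` H"
  defines "G \<equiv> GSp\<lparr>carrier := H\<rparr>"
    and "G2 \<equiv> GSp\<lparr>carrier := H2\<rparr>"
    and "T \<equiv> top_of_set H"
    and "T2 \<equiv> discrete_topology H2"
  defines "\<Phi> \<equiv> \<lambda>S. (ab_class T2 G2 (red2_mat S), multiplier S)"
  assumes "CARD('g) \<ge> 2"
    and "CARD('m) = 2 * CARD('g) + 2"
    and "symp_identification \<iota>"
    and "subgroup H GSp"
    and "H = {S \<in> carrier GSp. red2_mat S \<in> H2}"
    and "sym_stabilizer \<iota> l \<subseteq> H2"
  shows "top_derived T G = {S \<in> carrier Sp. red2_mat S \<in> top_derived T2 G2} \<and>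
    \<Phi> \<in> hom G (top_ab T2 G2 \<times>\<times> z2_units) \<and>
    (\<exists>\<Psi>. \<Psi> \<in> iso (top_ab T G) (top_ab T2 G2 \<times>\<times> z2_units) \<and>
         homeomorphic_map (ab_topology T G)
           (prod_topology (ab_topology T2 G2) z2_units_topology) \<Psi> \<and>
         (\<forall>S\<in>H. \<Psi> (ab_class T G S) = \<Phi> S))"
proof -
  have "even CARD('m)" using \<open>CARD('m) = 2 * CARD('g) + 2\<close> by simp
  then interpret full_preimage_transvections H
    using \<open>symp_identification \<iota>\<close> \<open>sym_stabilizer \<iota> l \<subseteq> H2\<close> \<open>subgroup H GSp\<close>
      \<open>H = {S \<in> carrier GSp. red2_mat S \<in> H2}\<close>
    unfolding H2_def by (rule full_preimage_transvections_if_sym_stabilizer)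
  have "\<Phi> = ab_multiplier"
    unfolding \<Phi>_def T2_def G2_def H2_def ab_multiplier_def ..
  then show ?thesis
    using top_derived_eq group_hom.homh[OF ab_multiplier_group_hom] top_ab_iso
    unfolding G_def G2_def T_def T2_def H2_def by simp
qed

end
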